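(* Let $k$ be a field, let $H$ be a Hopf algebra over $k$ with bijective antipode $S$, let $A$ be a left $H$-module algebra, and let $M$ be a stable left-left anti-Yetter-Drinfeld contramodule over $H$ with contramodule structure map $\alpha:\mathrm{Hom}(H,M)\to M$. For all integers $n\ge 0$ let $C^n_H(A,M):=\mathrm{Hom}_H(A^{\otimes n+1},M)$ be the space of left $H$-linear maps, where $A^{\otimes n+1}$ is a left $H$-module by the diagonal action. Define maps $\delta_i: C^{n-1}_H(A,M)\to C^n_H(A,M)$ ($0\le i\le n$, $n\geq 1$), $\sigma_j: C^{n+1}_H(A,M)\to C^n_H(A,M)$ ($0\le j\le n$) and $\tau_n: C^n_H(A,M)\to C^n_H(A,M)$ by $$\delta_i(f)(a^0,\ldots,a^n) = f(a^0,\ldots,a^{i-1},a^ia^{i+1},a^{i+2},\ldots,a^n),\qquad 0\le i<n,$$ $$\delta_n(f)(a^0,\ldots,a^n) = \alpha\left(f\left(((-)\cdot a^n)a^0,a^1,\ldots,a^{n-1}\right)\right),$$ $$\sigma_j(f)(a^0,\ldots,a^n) = f(a^0,\ldots,a^j,1_A,a^{j+1},\ldots,a^n),$$ $$\tau_n(f)(a^0,\ldots,a^n) = \alpha\left(f\left((-)\cdot a^n,a^0,a^1,\ldots,a^{n-1}\right)\right).$$ Then $C^*_H(A,M)$ with these $\delta_i$, $\sigma_j$, $\tau_n$ is a cocyclic module.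
   Context: All algebras are associative and unital and all coalgebras are coassociative and counital over the field $k$. $\mathrm{Hom}(V,W)$ denotes the space of $k$-linear maps. Sweedler notation is used: $\Delta(c)=c_{(1)}\otimes c_{(2)}$, etc., with summation implicit. A linear map on $A^{\otimes n+1}$ is written as a function of $n+1$ arguments. The symbol $(-)$ denotes the free argument in $H$: $\alpha(g(-))$ means $\alpha$ applied to the linear map $h'\mapsto g(h')$. Left $H$-module algebra: an algebra $A$ that is a left $H$-module with $h\cdot(aa')=(h_{(1)}\cdot a)(h_{(2)}\cdot a')$ and $h\cdot 1_A=\varepsilon_H(h)1_A$ for all $h\in H$, $a,a'\in A$. The diagonal action on $A^{\otimes n+1}$ is $h\cdot(a^0\otimes\cdots\otimes a^n)=h_{(1)}\cdot a^0\otimes h_{(2)}\cdot a^1\otimes\cdots\otimes h_{(n+1)}\cdot a^n$. Left contramodule of a coalgebra $D$: a vector space $M$ with a $k$-linear map $\alpha:\mathrm{Hom}(D,M)\to M$ such that, for all $f\in\mathrm{Hom}(D\otimes D,M)$ and $m\in M$, $$\alpha\big(x\mapsto \alpha(y\mapsto f(y\otimes x))\big)=\alpha\big(x\mapsto f(x_{(1)}\otimes x_{(2)})\big),\qquad \alpha\big(x\mapsto\varepsilon_D(x)m\big)=m.$$ Left-left anti-Yetter-Drinfeld contramodule over $H$: a vector space $M$ that is a left $H$-module and a left $H$-contramodule (over the coalgebra $H$) with structure map $\alpha$, such that for all $h\in H$ and $f\in\mathrm{Hom}(H,M)$, $$h\cdot\alpha(f)=\alpha\big(h'\mapsto h_{(2)}\cdot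 f(S^{-1}(h_{(1)})\,h'\,h_{(3)})\big).$$ It is stable if $\alpha(r_m)=m$ for all $m\in M$, where $r_m:H\to M$, $h\mapsto h\cdot m$. Cocyclic module: a cosimplicial $k$-vector space (cofaces $\delta_i$, codegeneracies $\sigma_j$ satisfying the usual cosimplicial identities) with linear maps $\tau_n$ in each degree $n\ge0$ such that $\tau_n\delta_i=\delta_{i-1}\tau_{n-1}$ for $1\le i\le n$, $\tau_n\delta_0=\delta_n$, $\tau_n\sigma_i=\sigma_{i-1}\tau_{n+1}$ for $1\le i\le n$, $\tau_n\sigma_0=\sigma_n\tau_{n+1}^2$, and $\tau_n^{n+1}=\mathrm{id}$. *)

theory Defs
  imports Complex_Main "HOL-Library.Function_Algebras"
begin

section \<open>Tensor powers of a vector space\<close>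

definition linear_on ::
  "'v set \<Rightarrow> ('k::field \<Rightarrow> 'v::ab_group_add \<Rightarrow> 'v) \<Rightarrow> ('k \<Rightarrow> 'w::ab_group_add \<Rightarrow> 'w) \<Rightarrow> ('v \<Rightarrow> 'w) \<Rightarrow> bool"
where
  "linear_on T sV sW f \<longleftrightarrow>
     (\<forall>x\<in>T. \<forall>y\<in>T. f (x + y) = f x + f y) \<and> (\<forall>c. \<forall>x\<in>T. f (sV c x) = sW c (f x))"

definition multilinear ::
  "('k::field \<Rightarrow> 'v::ab_group_add \<Rightarrow> 'v) \<Rightarrow> ('k \<Rightarrow> 'w::ab_group_add \<Rightarrow> 'w) \<Rightarrow> nat \<Rightarrow> ('v list \<Rightarrow> 'w) \<Rightarrow> bool"
where
  "multilinear sV sW n g \<longleftrightarrow>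
     (\<forall>vs i x y c. length vs = n \<longrightarrow> i < n \<longrightarrow>
        g (vs[i := x + y]) = g (vs[i := x]) + g (vs[i := y]) \<and>
        g (vs[i := sV c x]) = sW c (g (vs[i := x])))"

text \<open>
  The \<open>n\<close>-th tensor power over the field \<open>k\<close> is realised inside the dual of the space of
  \<open>n\<close>-linear forms: the pure tensor \<open>v\<^sub>1 \<otimes> \<dots> \<otimes> v\<^sub>n\<close> is evaluation of forms at \<open>(v\<^sub>1, \<dots>, v\<^sub>n)\<close>, and
  the tensor power is the span of the pure tensors.  That this is the tensor power, i.e. has
  the universal property for multilinear maps into arbitrary vector spaces, is
  \<open>tensor_universal_property\<close> below.
\<close>

type_synonym ('k, 'v) tensor = "('v list \<Rightarrow> 'k) \<Rightarrow> 'k"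

definition scale_fun :: "('k \<Rightarrow> 'w \<Rightarrow> 'w) \<Rightarrow> 'k \<Rightarrow> ('v \<Rightarrow> 'w) \<Rightarrow> 'v \<Rightarrow> 'w" where
  "scale_fun sW c f = (\<lambda>x. sW c (f x))"

abbreviation tscale :: "'k::field \<Rightarrow> ('k, 'v) tensor \<Rightarrow> ('k, 'v) tensor" where
  "tscale \<equiv> scale_fun (*)"

definition pure_tensor ::
  "('k::field \<Rightarrow> 'v::ab_group_add \<Rightarrow> 'v) \<Rightarrow> 'v list \<Rightarrow> ('k, 'v) tensor"
where
  "pure_tensor sV vs = (\<lambda>F. if multilinear sV (*) (length vs) F then F vs else 0)"

definition tensor_power ::
  "('k::field \<Rightarrow> 'v::ab_group_add \<Rightarrow> 'v) \<Rightarrow> nat \<Rightarrow> ('k, 'v) tensor set"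
where
  "tensor_power sV n = module.span tscale (pure_tensor sV ` {vs. length vs = n})"

text \<open>Linear maps out of a tensor power are extended by \<open>0\<close> off it, so that equality of such
  maps is equality of functions.\<close>

definition tensor_hom ::
  "('k::field \<Rightarrow> 'v::ab_group_add \<Rightarrow> 'v) \<Rightarrow> nat \<Rightarrow> ('k \<Rightarrow> 'w::ab_group_add \<Rightarrow> 'w)
     \<Rightarrow> (('k, 'v) tensor \<Rightarrow> 'w) set"
where
  "tensor_hom sV n sW =
     {f. linear_on (tensor_power sV n) tscale sW f \<and> (\<forall>t. t \<notin> tensor_power sV n \<longrightarrow> f t = 0)}"

text \<open>The linear map with prescribed values on pure tensors; meaningful for multilinear \<open>g\<close>.\<close>

definition tensor_lift ::
  "('k::field \<Rightarrow> 'v::ab_group_add \<Rightarrow> 'v) \<Rightarrow> ('k \<Rightarrow> 'w::ab_group_add \<Rightarrow> 'w) \<Rightarrow> nat \<Rightarrow> ('v list \<Rightarrow> 'w)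
     \<Rightarrow> ('k, 'v) tensor \<Rightarrow> 'w"
where
  "tensor_lift sV sW n g =
     (THE f. f \<in> tensor_hom sV n sW \<and> (\<forall>vs. length vs = n \<longrightarrow> f (pure_tensor sV vs) = g vs))"

definition lift2 ::
  "('k::field \<Rightarrow> 'v::ab_group_add \<Rightarrow> 'v) \<Rightarrow> ('k \<Rightarrow> 'w::ab_group_add \<Rightarrow> 'w) \<Rightarrow> ('v \<Rightarrow> 'v \<Rightarrow> 'w)
     \<Rightarrow> ('k, 'v) tensor \<Rightarrow> 'w"
where
  "lift2 sV sW g = tensor_lift sV sW 2 (\<lambda>vs. g (vs ! 0) (vs ! 1))"

definition lift3 ::
  "('k::field \<Rightarrow> 'v::ab_group_add \<Rightarrow> 'v) \<Rightarrow> ('k \<Rightarrow> 'w::ab_group_add \<Rightarrow> 'w) \<Rightarrow> ('v \<Rightarrow> 'v \<Rightarrow> 'v \<Rightarrow> 'w)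
     \<Rightarrow> ('k, 'v) tensor \<Rightarrow> 'w"
where
  "lift3 sV sW g = tensor_lift sV sW 3 (\<lambda>vs. g (vs ! 0) (vs ! 1) (vs ! 2))"

lemma vector_space_scale_fun:
  assumes "vector_space sW"
  shows "vector_space (scale_fun sW)"
proof -
  interpret vector_space sW by fact
  show ?thesis
    by unfold_locales (auto simp: scale_fun_def fun_eq_iff algebra_simps scale_left_distrib scale_right_distrib)
qed

lemma vector_space_mult: "vector_space ((*) :: 'k::field \<Rightarrow> 'k \<Rightarrow> 'k)"
  by unfold_locales (auto simp: algebra_simps)

lemma vector_space_tscale: "vector_space (tscale :: 'k::field \<Rightarrow> ('k, 'v) tensor \<Rightarrow> _)"
  by (rule vector_space_scale_fun[OF vector_space_mult])

lemma exists_functional: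
  assumes "vector_space (sW :: 'k::field \<Rightarrow> 'w::ab_group_add \<Rightarrow> 'w)" "w \<noteq> 0"
  shows "\<exists>l. Vector_Spaces.linear sW (*) l \<and> l w \<noteq> (0::'k)"
proof -
  interpret W: vector_space sW by fact
  interpret P: vector_space_pair sW "(*) :: 'k \<Rightarrow> 'k \<Rightarrow> 'k"
    by (intro vector_space_pair.intro assms vector_space_mult)
  have "W.independent {w}"
    using assms(2) by (simp add: W.dependent_single)
  from P.linear_independent_extend[OF this, of "\<lambda>_. 1"] show ?thesis by auto
qed

lemma tensor_power_subspace:
  "module.subspace (tscale :: 'k::field \<Rightarrow> _) (tensor_power sV n)"
proof -
  interpret T: vector_space "tscale :: 'k \<Rightarrow> ('k, 'v) tensor \<Rightarrow> _" by (rule vector_space_tscale)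
  show ?thesis unfolding tensor_power_def by (rule T.subspace_span)
qed

lemma tensor_power_add:
  "s \<in> tensor_power sV n \<Longrightarrow> t \<in> tensor_power sV n \<Longrightarrow> s + t \<in> tensor_power sV n"
  by (rule module.subspace_add[OF _ tensor_power_subspace])
    (auto intro: vector_space_tscale simp: module_iff_vector_space)

lemma tensor_power_scale:
  "t \<in> tensor_power sV n \<Longrightarrow> tscale c t \<in> tensor_power sV n"
  by (rule module.subspace_scale[OF _ tensor_power_subspace])
    (auto intro: vector_space_tscale simp: module_iff_vector_space)

lemma pure_in_tensor_power: "length vs = n \<Longrightarrow> pure_tensor sV vs \<in> tensor_power sV n"
  unfolding tensor_power_def
  by (rule module.span_base) (auto intro: vector_space_tscale simp: module_iff_vector_space)

lemma tensor_power_induct [consumes 1, case_names zero pure add scale]: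
  fixes sV :: "'k::field \<Rightarrow> 'v::ab_group_add \<Rightarrow> 'v"
  assumes "t \<in> tensor_power sV n"
    and "P 0"
    and "\<And>vs. length vs = n \<Longrightarrow> P (pure_tensor sV vs)"
    and "\<And>s t. s \<in> tensor_power sV n \<Longrightarrow> t \<in> tensor_power sV n \<Longrightarrow> P s \<Longrightarrow> P t \<Longrightarrow> P (s + t)"
    and "\<And>c t. t \<in> tensor_power sV n \<Longrightarrow> P t \<Longrightarrow> P (tscale c t)"
  shows "P t"
proof -
  interpret T: vector_space "tscale :: 'k \<Rightarrow> ('k, 'v) tensor \<Rightarrow> _" by (rule vector_space_tscale)
  have z: "0 \<in> tensor_power sV n" unfolding tensor_power_def by (rule T.span_zero)
  have "t \<in> tensor_power sV n \<and> P t"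
    using assms(1)[unfolded tensor_power_def]
  proof (induction rule: T.span_induct_alt)
    case base
    show ?case using z assms(2) by (rule conjI)
  next
    case (step c x y)
    then show ?case
      using assms(3-5) pure_in_tensor_power[of _ n sV] tensor_power_add[of _ sV n] tensor_power_scale[of _ sV n]
      by (metis (mono_tags, lifting) imageE mem_Collect_eq)
  qed
  then show ?thesis by simp
qed

lemma multilinear_pure: "multilinear sV tscale n (pure_tensor sV)"
  unfolding multilinear_def pure_tensor_def scale_fun_def
  by (auto simp: fun_eq_iff multilinear_def)

lemma multilinear_compose:
  assumes "linear_on (tensor_power sV n) tscale sW f"
  shows "multilinear sV sW n (\<lambda>vs. f (pure_tensor sV vs))"
  using assms multilinear_pure[of sV n] pure_in_tensor_power[of _ n sV]
  unfolding multilinear_def linear_on_def by simp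

theorem tensor_universal_property:
  fixes sV :: "'k::field \<Rightarrow> 'v::ab_group_add \<Rightarrow> 'v" and sW :: "'k \<Rightarrow> 'w::ab_group_add \<Rightarrow> 'w"
  assumes W: "vector_space sW" and g: "multilinear sV sW n g"
  shows "\<exists>!f. f \<in> tensor_hom sV n sW \<and> (\<forall>vs. length vs = n \<longrightarrow> f (pure_tensor sV vs) = g vs)"
proof -
  interpret W: vector_space sW by fact
  interpret T: vector_space "tscale :: 'k \<Rightarrow> ('k, 'v) tensor \<Rightarrow> _" by (rule vector_space_tscale)
  define R where "R t w \<longleftrightarrow> (\<forall>l. Vector_Spaces.linear sW (*) l \<longrightarrow> t (l \<circ> g) = l w)" for t w
  have lin: "l (x + y) = l x + l y" "l (sW c x) = c * l x" "l 0 = 0" "l (x - y) = l x - l y"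
    if "Vector_Spaces.linear sW (*) l" for l :: "'w \<Rightarrow> 'k" and x y c
  proof -
    interpret L: Vector_Spaces.linear sW "(*)" l by fact
    show "l (x + y) = l x + l y" "l (sW c x) = c * l x" "l 0 = 0" "l (x - y) = l x - l y"
      by (simp_all add: L.add L.scale L.diff)
  qed
  have R_pure: "R (pure_tensor sV vs) (g vs)" if "length vs = n" for vs
  proof -
    have "multilinear sV (*) n (l \<circ> g)" if "Vector_Spaces.linear sW (*) l" for l
      using g lin[OF that] unfolding multilinear_def by auto
    then show ?thesis using that unfolding R_def pure_tensor_def by auto
  qed
  have R_add: "R (s + t) (v + w)" if "R s v" "R t w" for s t v w
    using that unfolding R_def by (auto simp: lin)
  have R_scale: "R (tscale c t) (sW c w)" if "R t w" for c t w
    using that unfolding R_def by (auto simp: lin scale_fun_def)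
  have R_unique: "v = w" if "R t v" "R t w" for t v w
  proof (rule ccontr)
    assume "v \<noteq> w"
    then obtain l where l: "Vector_Spaces.linear sW (*) l" "l (v - w) \<noteq> (0::'k)"
      using exists_functional[OF W, of "v - w"] by auto
    then show False using that unfolding R_def by (auto simp: lin)
  qed
  have R_ex: "\<exists>w. R t w" if "t \<in> tensor_power sV n" for t
    using that
  proof (induction rule: tensor_power_induct)
    case zero
    show ?case by (rule exI[of _ 0]) (auto simp: R_def lin)
  qed (use R_pure R_add R_scale in blast)+
  define f where "f t = (if t \<in> tensor_power sV n then THE w. R t w else 0)" for t
  have fR: "f t = w" if "t \<in> tensor_power sV n" "R t w" for t w
    using that R_unique unfolding f_def by auto
  have Rf: "R t (f t)" if "t \<in> tensor_power sV n" for t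
    using R_ex[OF that] fR[OF that] by auto
  have 1: "f \<in> tensor_hom sV n sW"
    unfolding tensor_hom_def linear_on_def
    by (auto simp: fR R_add R_scale Rf tensor_power_add tensor_power_scale) (simp add: f_def)
  have 2: "f (pure_tensor sV vs) = g vs" if "length vs = n" for vs
    using fR pure_in_tensor_power R_pure that by blast
  show ?thesis
  proof (rule ex1I[of _ f])
    show "f \<in> tensor_hom sV n sW \<and> (\<forall>vs. length vs = n \<longrightarrow> f (pure_tensor sV vs) = g vs)"
      using 1 2 by blast
  next
    fix f'
    assume f': "f' \<in> tensor_hom sV n sW \<and> (\<forall>vs. length vs = n \<longrightarrow> f' (pure_tensor sV vs) = g vs)"
    have z: "h 0 = 0" if "h \<in> tensor_hom sV n sW" for h
    proof -
      have "0 \<in> tensor_power sV n" unfolding tensor_power_def by (rule T.span_zero)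
      then have "h (tscale 0 0) = sW 0 (h 0)"
        using that unfolding tensor_hom_def linear_on_def by blast
      then show ?thesis by simp
    qed
    have "f' t = f t" if "t \<in> tensor_power sV n" for t
      using that
    proof (induction rule: tensor_power_induct)
      case zero
      show ?case using z[of f] z[of f'] 1 f' by metis
    next
      case (pure vs)
      then show ?case using f' 2 by simp
    next
      case (add s t)
      then have "f' (s + t) = f' s + f' t" "f (s + t) = f s + f t"
        using f' 1 unfolding tensor_hom_def linear_on_def by blast+
      then show ?case using add by metis
    next
      case (scale c t)
      then have "f' (tscale c t) = sW c (f' t)" "f (tscale c t) = sW c (f t)"
        using f' 1 unfolding tensor_hom_def linear_on_def by blast+
      then show ?case using scale by metis
    qed
    moreover have "f' t = f t" if "t \<notin> tensor_power sV n" for t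
      using that f' 1 unfolding tensor_hom_def by simp
    ultimately show "f' = f" by blast
  qed
qed

lemma
  assumes "vector_space sW" "multilinear sV sW n g"
  shows tensor_lift_hom: "tensor_lift sV sW n g \<in> tensor_hom sV n sW"
    and tensor_lift_pure: "length vs = n \<Longrightarrow> tensor_lift sV sW n g (pure_tensor sV vs) = g vs"
  using theI'[OF tensor_universal_property[OF assms]] unfolding tensor_lift_def by auto


section \<open>Algebras, coalgebras and Hopf algebras\<close>

text \<open>The sort \<open>{ring, monoid_mult}\<close> is used rather than \<open>ring_1\<close>, as the latter excludes the
  zero ring.\<close>

locale k_algebra = vector_space scale
  for scale :: "'k::field \<Rightarrow> 'a::{ring,monoid_mult} \<Rightarrow> 'a" +
  assumes scale_mult_left: "scale c x * y = scale c (x * y)"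
    and scale_mult_right: "x * scale c y = scale c (x * y)"

text \<open>An expression \<open>F(c\<^sub>(\<^sub>1\<^sub>), c\<^sub>(\<^sub>2\<^sub>))\<close> in Sweedler notation is
  \<open>lift2 scale sW F (\<Delta> c)\<close>.\<close>

locale k_coalgebra = vector_space scale
  for scale :: "'k::field \<Rightarrow> 'c::ab_group_add \<Rightarrow> 'c" +
  fixes \<Delta> :: "'c \<Rightarrow> ('k, 'c) tensor" and \<epsilon> :: "'c \<Rightarrow> 'k"
  assumes comult_in: "\<Delta> c \<in> tensor_power scale 2"
    and comult_linear: "Vector_Spaces.linear scale tscale \<Delta>"
    and counit_linear: "Vector_Spaces.linear scale (*) \<epsilon>"
    and coassoc:
      "lift2 scale tscale (\<lambda>x y. lift2 scale tscale (\<lambda>x1 x2. pure_tensor scale [x1, x2, y]) (\<Delta> x)) (\<Delta> c) =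
       lift2 scale tscale (\<lambda>x y. lift2 scale tscale (\<lambda>y1 y2. pure_tensor scale [x, y1, y2]) (\<Delta> y)) (\<Delta> c)"
    and counit_left: "lift2 scale scale (\<lambda>x y. scale (\<epsilon> x) y) (\<Delta> c) = c"
    and counit_right: "lift2 scale scale (\<lambda>x y. scale (\<epsilon> y) x) (\<Delta> c) = c"

locale k_bialgebra = k_algebra scale + k_coalgebra scale \<Delta> \<epsilon>
  for scale :: "'k::field \<Rightarrow> 'h::{ring,monoid_mult} \<Rightarrow> 'h"
    and \<Delta> :: "'h \<Rightarrow> ('k, 'h) tensor" and \<epsilon> :: "'h \<Rightarrow> 'k" +
  assumes comult_mult:
      "\<Delta> (x * y) =
       lift2 scale tscale (\<lambda>x1 x2. lift2 scale tscale (\<lambda>y1 y2. pure_tensor scale [x1 * y1, x2 * y2]) (\<Delta> y)) (\<Delta> x)"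
    and comult_one: "\<Delta> 1 = pure_tensor scale [1, 1]"
    and counit_mult: "\<epsilon> (x * y) = \<epsilon> x * \<epsilon> y"
    and counit_one: "\<epsilon> 1 = 1"

locale hopf_algebra = k_bialgebra scale \<Delta> \<epsilon>
  for scale :: "'k::field \<Rightarrow> 'h::{ring,monoid_mult} \<Rightarrow> 'h"
    and \<Delta> :: "'h \<Rightarrow> ('k, 'h) tensor" and \<epsilon> :: "'h \<Rightarrow> 'k" +
  fixes S :: "'h \<Rightarrow> 'h"
  assumes antipode_linear: "Vector_Spaces.linear scale scale S"
    and antipode_left: "lift2 scale scale (\<lambda>x y. S x * y) (\<Delta> h) = scale (\<epsilon> h) 1"
    and antipode_right: "lift2 scale scale (\<lambda>x y. x * S y) (\<Delta> h) = scale (\<epsilon> h) 1"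

text \<open>\<open>iter_comult scale \<Delta> n h\<close> is \<open>h\<^sub>(\<^sub>1\<^sub>) \<otimes> \<dots> \<otimes> h\<^sub>(\<^sub>n\<^sub>+\<^sub>1\<^sub>)\<close>, obtained by applying \<open>\<Delta>\<close> repeatedly to the
  first tensor factor.\<close>

primrec iter_comult ::
  "('k::field \<Rightarrow> 'h::ab_group_add \<Rightarrow> 'h) \<Rightarrow> ('h \<Rightarrow> ('k, 'h) tensor) \<Rightarrow> nat \<Rightarrow> 'h \<Rightarrow> ('k, 'h) tensor"
where
  "iter_comult scale \<Delta> 0 h = pure_tensor scale [h]"
| "iter_comult scale \<Delta> (Suc n) h =
     tensor_lift scale tscale (Suc n)
       (\<lambda>vs. lift2 scale tscale (\<lambda>x y. pure_tensor scale (x # y # tl vs)) (\<Delta> (hd vs)))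
       (iter_comult scale \<Delta> n h)"


section \<open>Modules, module algebras and contramodules\<close>

locale left_module = H: k_algebra sH + M: vector_space sM
  for sH :: "'k::field \<Rightarrow> 'h::{ring,monoid_mult} \<Rightarrow> 'h"
    and sM :: "'k \<Rightarrow> 'm::ab_group_add \<Rightarrow> 'm" +
  fixes act :: "'h \<Rightarrow> 'm \<Rightarrow> 'm"
  assumes act_add_left: "act (g + h) m = act g m + act h m"
    and act_scale_left: "act (sH c h) m = sM c (act h m)"
    and act_add_right: "act h (m + m') = act h m + act h m'"
    and act_scale_right: "act h (sM c m) = sM c (act h m)"
    and act_mult: "act (g * h) m = act g (act h m)"
    and act_one: "act 1 m = m"

locale left_module_algebra =
  k_bialgebra sH \<Delta> \<epsilon> + A: k_algebra sA + left_module sH sA act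
  for sH :: "'k::field \<Rightarrow> 'h::{ring,monoid_mult} \<Rightarrow> 'h"
    and \<Delta> :: "'h \<Rightarrow> ('k, 'h) tensor" and \<epsilon> :: "'h \<Rightarrow> 'k"
    and sA :: "'k \<Rightarrow> 'a::{ring,monoid_mult} \<Rightarrow> 'a"
    and act :: "'h \<Rightarrow> 'a \<Rightarrow> 'a" +
  assumes act_product: "act h (a * b) = lift2 sH sA (\<lambda>h1 h2. act h1 a * act h2 b) (\<Delta> h)"
    and act_unit: "act h 1 = sA (\<epsilon> h) 1"

text \<open>Only the values of \<open>\<alpha>\<close> on linear maps are relevant.\<close>

locale left_contramodule = D: k_coalgebra sD \<Delta> \<epsilon> + M: vector_space sM
  for sD :: "'k::field \<Rightarrow> 'd::ab_group_add \<Rightarrow> 'd"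
    and \<Delta> :: "'d \<Rightarrow> ('k, 'd) tensor" and \<epsilon> :: "'d \<Rightarrow> 'k"
    and sM :: "'k \<Rightarrow> 'm::ab_group_add \<Rightarrow> 'm" +
  fixes \<alpha> :: "('d \<Rightarrow> 'm) \<Rightarrow> 'm"
  assumes contra_add:
      "Vector_Spaces.linear sD sM f \<Longrightarrow> Vector_Spaces.linear sD sM g \<Longrightarrow>
       \<alpha> (\<lambda>x. f x + g x) = \<alpha> f + \<alpha> g"
    and contra_scale:
      "Vector_Spaces.linear sD sM f \<Longrightarrow> \<alpha> (\<lambda>x. sM c (f x)) = sM c (\<alpha> f)"
    and contra_assoc:
      "F \<in> tensor_hom sD 2 sM \<Longrightarrow>
       \<alpha> (\<lambda>x. \<alpha> (\<lambda>y. F (pure_tensor sD [y, x]))) = \<alpha> (\<lambda>x. F (\<Delta> x))"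
    and contra_counit: "\<alpha> (\<lambda>x. sM (\<epsilon> x) m) = m"

text \<open>\<open>S\<^sup>-\<^sup>1\<close> is rendered by \<open>inv S\<close>, which is the inverse only for bijective \<open>S\<close>.\<close>

locale ayd_contramodule =
  hopf_algebra sH \<Delta> \<epsilon> S + left_module sH sM act + left_contramodule sH \<Delta> \<epsilon> sM \<alpha>
  for sH :: "'k::field \<Rightarrow> 'h::{ring,monoid_mult} \<Rightarrow> 'h"
    and \<Delta> :: "'h \<Rightarrow> ('k, 'h) tensor" and \<epsilon> :: "'h \<Rightarrow> 'k" and S :: "'h \<Rightarrow> 'h"
    and sM :: "'k \<Rightarrow> 'm::ab_group_add \<Rightarrow> 'm"
    and act :: "'h \<Rightarrow> 'm \<Rightarrow> 'm" and \<alpha> :: "('h \<Rightarrow> 'm) \<Rightarrow> 'm" +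
  assumes ayd_compat:
      "Vector_Spaces.linear sH sM f \<Longrightarrow>
       act h (\<alpha> f) =
       \<alpha> (\<lambda>h'. lift3 sH sM (\<lambda>h1 h2 h3. act h2 (f (inv S h1 * h' * h3))) (iter_comult sH \<Delta> 2 h))"

locale stable_ayd_contramodule = ayd_contramodule +
  assumes stable: "\<alpha> (\<lambda>h. act h m) = m"


section \<open>Cocyclic modules\<close>

text \<open>The spaces \<open>C n\<close> are subspaces of one ambient vector space; here \<open>\<delta> n i : C n \<rightarrow> C (n + 1)\<close>
  and \<open>\<sigma> n j : C (n + 1) \<rightarrow> C n\<close>.\<close>

locale cosimplicial_space = vector_space scale
  for scale :: "'k::field \<Rightarrow> 'v::ab_group_add \<Rightarrow> 'v" +
  fixes C :: "nat \<Rightarrow> 'v set" and \<delta> \<sigma> :: "nat \<Rightarrow> nat \<Rightarrow> 'v \<Rightarrow> 'v"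
  assumes C_subspace: "subspace (C n)"
    and coface_in: "i \<le> Suc n \<Longrightarrow> x \<in> C n \<Longrightarrow> \<delta> n i x \<in> C (Suc n)"
    and coface_linear: "i \<le> Suc n \<Longrightarrow> linear_on (C n) scale scale (\<delta> n i)"
    and codegen_in: "j \<le> n \<Longrightarrow> x \<in> C (Suc n) \<Longrightarrow> \<sigma> n j x \<in> C n"
    and codegen_linear: "j \<le> n \<Longrightarrow> linear_on (C (Suc n)) scale scale (\<sigma> n j)"
    and coface_coface:
      "i < j \<Longrightarrow> j \<le> Suc (Suc n) \<Longrightarrow> x \<in> C n \<Longrightarrow>
       \<delta> (Suc n) j (\<delta> n i x) = \<delta> (Suc n) i (\<delta> n (j - 1) x)"
    and codegen_codegen:
      "i \<le> j \<Longrightarrow> j \<le> n \<Longrightarrow> x \<in> C (Suc (Suc n)) \<Longrightarrow>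
       \<sigma> n j (\<sigma> (Suc n) i x) = \<sigma> n i (\<sigma> (Suc n) (Suc j) x)"
    and codegen_coface_less:
      "i < j \<Longrightarrow> j \<le> Suc n \<Longrightarrow> x \<in> C (Suc n) \<Longrightarrow>
       \<sigma> (Suc n) j (\<delta> (Suc n) i x) = \<delta> n i (\<sigma> n (j - 1) x)"
    and codegen_coface_id:
      "j \<le> n \<Longrightarrow> i = j \<or> i = Suc j \<Longrightarrow> x \<in> C n \<Longrightarrow> \<sigma> n j (\<delta> n i x) = x"
    and codegen_coface_greater:
      "Suc j < i \<Longrightarrow> i \<le> Suc (Suc n) \<Longrightarrow> x \<in> C (Suc n) \<Longrightarrow>
       \<sigma> (Suc n) j (\<delta> (Suc n) i x) = \<delta> n (i - 1) (\<sigma> n j x)"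

locale cocyclic_module = cosimplicial_space scale C \<delta> \<sigma>
  for scale :: "'k::field \<Rightarrow> 'v::ab_group_add \<Rightarrow> 'v"
    and C :: "nat \<Rightarrow> 'v set" and \<delta> \<sigma> :: "nat \<Rightarrow> nat \<Rightarrow> 'v \<Rightarrow> 'v" +
  fixes \<tau> :: "nat \<Rightarrow> 'v \<Rightarrow> 'v"
  assumes cyclic_in: "x \<in> C n \<Longrightarrow> \<tau> n x \<in> C n"
    and cyclic_linear: "linear_on (C n) scale scale (\<tau> n)"
    and cyclic_coface:
      "1 \<le> i \<Longrightarrow> i \<le> Suc n \<Longrightarrow> x \<in> C n \<Longrightarrow> \<tau> (Suc n) (\<delta> n i x) = \<delta> n (i - 1) (\<tau> n x)"
    and cyclic_coface_zero: "x \<in> C n \<Longrightarrow> \<tau> (Suc n) (\<delta> n 0 x) = \<delta> n (Suc n) x"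
    and cyclic_codegen:
      "1 \<le> i \<Longrightarrow> i \<le> n \<Longrightarrow> x \<in> C (Suc n) \<Longrightarrow> \<tau> n (\<sigma> n i x) = \<sigma> n (i - 1) (\<tau> (Suc n) x)"
    and cyclic_codegen_zero:
      "x \<in> C (Suc n) \<Longrightarrow> \<tau> n (\<sigma> n 0 x) = \<sigma> n n (\<tau> (Suc n) (\<tau> (Suc n) x))"
    and cyclic_power: "x \<in> C n \<Longrightarrow> (\<tau> n ^^ Suc n) x = x"


section \<open>The complex of a module algebra with contramodule coefficients\<close>

text \<open>The action of \<open>h\<close> on the \<open>(n + 1)\<close>-st tensor power.\<close>

definition diagonal_action ::
  "('k::field \<Rightarrow> 'h::ab_group_add \<Rightarrow> 'h) \<Rightarrow> ('h \<Rightarrow> ('k, 'h) tensor)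
     \<Rightarrow> ('k \<Rightarrow> 'a::ab_group_add \<Rightarrow> 'a) \<Rightarrow> ('h \<Rightarrow> 'a \<Rightarrow> 'a) \<Rightarrow> nat \<Rightarrow> 'h
     \<Rightarrow> ('k, 'a) tensor \<Rightarrow> ('k, 'a) tensor"
where
  "diagonal_action sH \<Delta> sA actA n h =
     tensor_lift sA tscale (Suc n)
       (\<lambda>as. tensor_lift sH tscale (Suc n) (\<lambda>hs. pure_tensor sA (map2 actA hs as)) (iter_comult sH \<Delta> n h))"

definition cochains ::
  "('k::field \<Rightarrow> 'h::ab_group_add \<Rightarrow> 'h) \<Rightarrow> ('h \<Rightarrow> ('k, 'h) tensor)
     \<Rightarrow> ('k \<Rightarrow> 'a::ab_group_add \<Rightarrow> 'a) \<Rightarrow> ('h \<Rightarrow> 'a \<Rightarrow> 'a)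
     \<Rightarrow> ('k \<Rightarrow> 'm::ab_group_add \<Rightarrow> 'm) \<Rightarrow> ('h \<Rightarrow> 'm \<Rightarrow> 'm)
     \<Rightarrow> nat \<Rightarrow> (('k, 'a) tensor \<Rightarrow> 'm) set"
where
  "cochains sH \<Delta> sA actA sM actM n =
     {f \<in> tensor_hom sA (Suc n) sM.
        \<forall>h. \<forall>t \<in> tensor_power sA (Suc n). f (diagonal_action sH \<Delta> sA actA n h t) = actM h (f t)}"

definition coface ::
  "('k::field \<Rightarrow> 'a::{ring,monoid_mult} \<Rightarrow> 'a) \<Rightarrow> ('h \<Rightarrow> 'a \<Rightarrow> 'a)
     \<Rightarrow> ('k \<Rightarrow> 'm::ab_group_add \<Rightarrow> 'm) \<Rightarrow> (('h \<Rightarrow> 'm) \<Rightarrow> 'm) \<Rightarrow> nat \<Rightarrow> nat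
     \<Rightarrow> (('k, 'a) tensor \<Rightarrow> 'm) \<Rightarrow> ('k, 'a) tensor \<Rightarrow> 'm"
where
  "coface sA actA sM \<alpha> n i f =
     tensor_lift sA sM (Suc (Suc n))
       (\<lambda>as. if i \<le> n
              then f (pure_tensor sA (take i as @ [as ! i * as ! Suc i] @ drop (Suc (Suc i)) as))
              else \<alpha> (\<lambda>h. f (pure_tensor sA ((actA h (last as) * hd as) # butlast (tl as)))))"

definition codegeneracy ::
  "('k::field \<Rightarrow> 'a::{ring,monoid_mult} \<Rightarrow> 'a) \<Rightarrow> ('k \<Rightarrow> 'm::ab_group_add \<Rightarrow> 'm) \<Rightarrow> nat \<Rightarrow> nat
     \<Rightarrow> (('k, 'a) tensor \<Rightarrow> 'm) \<Rightarrow> ('k, 'a) tensor \<Rightarrow> 'm"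
where
  "codegeneracy sA sM n j f =
     tensor_lift sA sM (Suc n) (\<lambda>as. f (pure_tensor sA (take (Suc j) as @ [1] @ drop (Suc j) as)))"

definition cyclic_operator ::
  "('k::field \<Rightarrow> 'a::ab_group_add \<Rightarrow> 'a) \<Rightarrow> ('h \<Rightarrow> 'a \<Rightarrow> 'a)
     \<Rightarrow> ('k \<Rightarrow> 'm::ab_group_add \<Rightarrow> 'm) \<Rightarrow> (('h \<Rightarrow> 'm) \<Rightarrow> 'm) \<Rightarrow> nat
     \<Rightarrow> (('k, 'a) tensor \<Rightarrow> 'm) \<Rightarrow> ('k, 'a) tensor \<Rightarrow> 'm"
where
  "cyclic_operator sA actA sM \<alpha> n f =
     tensor_lift sA sM (Suc n) (\<lambda>as. \<alpha> (\<lambda>h. f (pure_tensor sA (actA h (last as) # butlast as))))"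

lemma cochain_multilinear:
  assumes "f \<in> cochains sH \<Delta> sA actA sM actM n"
  shows "multilinear sA sM (Suc n) (\<lambda>as. f (pure_tensor sA as))"
  using assms multilinear_compose unfolding cochains_def tensor_hom_def by blast

lemma multilinearD:
  assumes "multilinear sV sW n g" "length vs = n" "i < n"
  shows "g (vs[i := x + y]) = g (vs[i := x]) + g (vs[i := y])"
    and "g (vs[i := sV c x]) = sW c (g (vs[i := x]))"
  using assms unfolding multilinear_def by auto

text \<open>The coface, codegeneracy and cyclic operators are given by the expected formulas on pure
  tensors.\<close>

lemma codegeneracy_pure:
  fixes sA :: "'k::field \<Rightarrow> 'a::{ring,monoid_mult} \<Rightarrow> 'a"
  assumes "vector_space sM" "f \<in> cochains sH \<Delta> sA actA sM actM (Suc n)" "j \<le> n" "length as = Suc n"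
  shows "codegeneracy sA sM n j f (pure_tensor sA as) =
         f (pure_tensor sA (take (Suc j) as @ [1] @ drop (Suc j) as))"
proof -
  define I where "I vs = take (Suc j) vs @ [1] @ drop (Suc j) vs" for vs :: "'a list"
  have len: "length (I vs) = Suc (Suc n)" if "length vs = Suc n" for vs
    using that assms(3) by (simp add: I_def)
  have upd: "I (vs[p := z]) = (I vs)[if p \<le> j then p else Suc p := z]"
    if "length vs = Suc n" "p < Suc n" for vs p z
    using that assms(3)
    by (intro nth_equalityI) (auto simp: I_def nth_append nth_list_update nth_Cons split: nat.splits)
  have "multilinear sA sM (Suc n) (\<lambda>vs. f (pure_tensor sA (I vs)))"
    unfolding multilinear_def
    using multilinearD[OF cochain_multilinear[OF assms(2)]] by (auto simp: upd len)
  from tensor_lift_pure[OF assms(1) this assms(4)] show ?thesis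
    unfolding codegeneracy_def I_def .
qed

lemma coface_pure:
  fixes sA :: "'k::field \<Rightarrow> 'a::{ring,monoid_mult} \<Rightarrow> 'a"
  assumes "vector_space sM" "k_algebra sA"
    and "f \<in> cochains sH \<Delta> sA actA sM actM n" "i \<le> n" "length as = Suc (Suc n)"
  shows "coface sA actA sM \<alpha> n i f (pure_tensor sA as) =
         f (pure_tensor sA (take i as @ [as ! i * as ! Suc i] @ drop (Suc (Suc i)) as))"
proof -
  interpret k_algebra sA by fact
  define I where "I vs = take i vs @ [vs ! i * vs ! Suc i] @ drop (Suc (Suc i)) vs" for vs :: "'a list"
  have len: "length (I vs) = Suc n" if "length vs = Suc (Suc n)" for vs
    using that assms(4) by (simp add: I_def)
  have upd: "I (vs[p := z]) =
      (I vs)[if p \<le> i then p else p - 1 :=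
        if p = i then z * vs ! Suc i else if p = Suc i then vs ! i * z else z]"
    if "length vs = Suc (Suc n)" "p < Suc (Suc n)" for vs p z
    using that assms(4)
    by (intro nth_equalityI) (auto simp: I_def nth_append nth_list_update nth_Cons split: nat.splits)
  have "multilinear sA sM (Suc (Suc n)) (\<lambda>vs. f (pure_tensor sA (I vs)))"
    unfolding multilinear_def
    using multilinearD[OF cochain_multilinear[OF assms(3)]] assms(4)
    by (auto simp: upd len distrib_left distrib_right scale_mult_left scale_mult_right)
  from tensor_lift_pure[OF assms(1) this assms(5)] show ?thesis
    unfolding coface_def I_def using assms(4) by simp
qed

lemma contramodule_lift_pure:
  fixes sA :: "'k::field \<Rightarrow> 'a::{ring,monoid_mult} \<Rightarrow> 'a"
    and J :: "'h::{ring,monoid_mult} \<Rightarrow> 'a list \<Rightarrow> 'a list"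
  assumes "left_contramodule sH \<Delta> \<epsilon> sM \<alpha>" and g: "multilinear sA sM m g"
    and len: "\<And>h vs. length vs = n \<Longrightarrow> length (J h vs) = m"
    and upd: "\<And>h vs p z. length vs = n \<Longrightarrow> p < n \<Longrightarrow> J h (vs[p := z]) = (J h vs)[q p := u h p vs z]"
    and q: "\<And>p. p < n \<Longrightarrow> q p < m"
    and u: "\<And>h vs p x y. u h p vs (x + y) = u h p vs x + u h p vs y"
      "\<And>h vs p x c. u h p vs (sA c x) = sA c (u h p vs x)"
    and J: "\<And>h vs. length vs = n \<Longrightarrow> J h vs = (J 0 vs)[0 := w h vs]" "0 < m"
    and w: "\<And>h h' vs. w (h + h') vs = w h vs + w h' vs" "\<And>c h vs. w (sH c h) vs = sA c (w h vs)"
    and as: "length as = n"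
  shows "tensor_lift sA sM n (\<lambda>vs. \<alpha> (\<lambda>h. g (J h vs))) (pure_tensor sA as) = \<alpha> (\<lambda>h. g (J h as))"
proof -
  interpret left_contramodule sH \<Delta> \<epsilon> sM \<alpha> by fact
  have lin: "Vector_Spaces.linear sH sM (\<lambda>h. g (J h vs))" if "length vs = n" for vs
  proof -
    have "g (J (h + h') vs) = g (J h vs) + g (J h' vs)" "g (J (sH c h) vs) = sM c (g (J h vs))" for h h' c
      using multilinearD[OF g len[OF that, of 0] J(2)] J(1)[OF that] w by metis+
    then show ?thesis
      by (simp add: Vector_Spaces.linear_iff D.vector_space_axioms M.vector_space_axioms)
  qed
  have "multilinear sA sM n (\<lambda>vs. \<alpha> (\<lambda>h. g (J h vs)))"
    unfolding multilinear_def
  proof (intro allI impI)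
    fix vs p x y c
    assume vs: "length (vs :: 'a list) = n" and p: "p < n"
    have "(\<lambda>h. g (J h (vs[p := x + y]))) = (\<lambda>h. g (J h (vs[p := x])) + g (J h (vs[p := y])))"
      "(\<lambda>h. g (J h (vs[p := sA c x]))) = (\<lambda>h. sM c (g (J h (vs[p := x]))))"
      using multilinearD[OF g len[OF vs] q[OF p]] by (auto simp: upd[OF vs p] u)
    then show "\<alpha> (\<lambda>h. g (J h (vs[p := x + y]))) = \<alpha> (\<lambda>h. g (J h (vs[p := x]))) + \<alpha> (\<lambda>h. g (J h (vs[p := y]))) \<and>
        \<alpha> (\<lambda>h. g (J h (vs[p := sA c x]))) = sM c (\<alpha> (\<lambda>h. g (J h (vs[p := x]))))"
      using vs by (simp add: contra_add contra_scale lin)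
  qed
  from tensor_lift_pure[OF M.vector_space_axioms this as] show ?thesis .
qed

lemma last_coface_pure:
  fixes sA :: "'k::field \<Rightarrow> 'a::{ring,monoid_mult} \<Rightarrow> 'a"
  assumes "left_contramodule sH \<Delta> \<epsilon> sM \<alpha>" "left_module sH sA actA" "k_algebra sA"
    and "f \<in> cochains sH \<Delta> sA actA sM actM n" "length as = Suc (Suc n)"
  shows "coface sA actA sM \<alpha> n (Suc n) f (pure_tensor sA as) =
         \<alpha> (\<lambda>h. f (pure_tensor sA ((actA h (last as) * hd as) # butlast (tl as))))"
proof -
  interpret left_module sH sA actA by fact
  interpret A: k_algebra sA by fact
  define J where "J h vs = (actA h (last vs) * hd vs) # butlast (tl vs)" for h and vs :: "'a list"
  have J: "J h vs = (J 0 vs)[0 := actA h (last vs) * hd vs]" for h vs by (simp add: J_def)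
  have len: "length (J h vs) = Suc n" if "length vs = Suc (Suc n)" for h vs
    using that by (simp add: J_def)
  have upd: "J h (vs[p := z]) = (J h vs)[if p = Suc n then 0 else p :=
      if p = 0 then actA h (last vs) * z else if p = Suc n then actA h z * hd vs else z]"
    if "length vs = Suc (Suc n)" "p < Suc (Suc n)" for h vs p z
    using that
    by (cases vs; cases p)
      (auto simp: J_def last_list_update butlast_list_update intro!: nth_equalityI split: nat.splits)
  show ?thesis
    unfolding coface_def
    using contramodule_lift_pure[OF assms(1) cochain_multilinear[OF assms(4)],
      where n = "Suc (Suc n)" and J = J and q = "\<lambda>p. if p = Suc n then 0 else p"
        and u = "\<lambda>h p vs z. if p = 0 then actA h (last vs) * z
           else if p = Suc n then actA h z * hd vs else z"
        and w = "\<lambda>h vs. actA h (last vs) * hd vs" and as = as, OF len upd _ _ _ J]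
    using assms(5)
    by (auto simp: act_add_left act_scale_left act_add_right act_scale_right distrib_left
        distrib_right A.scale_mult_left A.scale_mult_right J_def)
qed

lemma cyclic_operator_pure:
  fixes sA :: "'k::field \<Rightarrow> 'a::{ring,monoid_mult} \<Rightarrow> 'a"
  assumes "left_contramodule sH \<Delta> \<epsilon> sM \<alpha>" "left_module sH sA actA"
    and "f \<in> cochains sH \<Delta> sA actA sM actM n" "length as = Suc n"
  shows "cyclic_operator sA actA sM \<alpha> n f (pure_tensor sA as) =
         \<alpha> (\<lambda>h. f (pure_tensor sA (actA h (last as) # butlast as)))"
proof -
  interpret left_module sH sA actA by fact
  define J where "J h vs = actA h (last vs) # butlast vs" for h and vs :: "'a list"
  have J: "J h vs = (J 0 vs)[0 := actA h (last vs)]" for h vs by (simp add: J_def)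
  have len: "length (J h vs) = Suc n" if "length vs = Suc n" for h vs
    using that by (simp add: J_def)
  have upd: "J h (vs[p := z]) = (J h vs)[if p = n then 0 else Suc p := if p = n then actA h z else z]"
    if "length vs = Suc n" "p < Suc n" for h vs p z
    using that by (cases "vs = []") (auto simp: J_def last_list_update butlast_list_update)
  show ?thesis
    unfolding cyclic_operator_def
    using contramodule_lift_pure[OF assms(1) cochain_multilinear[OF assms(3)],
      where n = "Suc n" and J = J and q = "\<lambda>p. if p = n then 0 else Suc p"
        and u = "\<lambda>h p vs z. if p = n then actA h z else z"
        and w = "\<lambda>h vs. actA h (last vs)" and as = as, OF len upd _ _ _ J]
    using assms(4)
    by (auto simp: act_add_left act_scale_left act_add_right act_scale_right J_def)
qed

end

theory Submission
  imports Defs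
begin

text \<open>
  On pure tensors every operator is an explicit formula, and cochains are determined by their
  values there. So each relation is an identity between multilinear expressions in
  \<open>a\<^sup>0, \<dots>, a\<^sup>n\<close>, and the task is to make the Sweedler calculus available for such expressions.
  This is done by choosing, for each element of the coalgebra, one way to write its coproduct as
  a finite sum of pure tensors: a Sweedler expression becomes a finite sum, and coassociativity,
  counit and module algebra laws become identities between finite sums of values of multilinear
  maps (\<open>sweedler_coassoc\<close>, \<open>sweedlers_split_entry\<close>, \<open>sweedlers_nested\<close>).

  Three facts carry the theorem. The cyclic operator preserves \<open>H\<close>-linearity (\<open>t_in\<close>): the
  anti-Yetter-Drinfeld condition turns \<open>h \<cdot> \<tau>(f)(a\<^sup>0, \<dots>, a\<^sup>n)\<close> into
  \<open>\<alpha>(f(h\<^sub>2 S\<^sup>-\<^sup>1(h\<^sub>1) (-) h\<^sub>n\<^sub>+\<^sub>3 \<cdot> a\<^sup>n, h\<^sub>3 \<cdot> a\<^sup>0, \<dots>))\<close>, and \<open>h\<^sub>2 S\<^sup>-\<^sup>1(h\<^sub>1) = \<epsilon>(h)\<close>, which holds because \<open>S\<close> is an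
  injective antihomomorphism. The contra-associativity law gives \<open>\<tau> \<delta>\<^sub>n = \<delta>\<^sub>n\<^sub>-\<^sub>1 \<tau>\<close> (\<open>t_d_last\<close>): two
  nested applications of \<open>\<alpha>\<close> merge into one in which the coproduct acts on a product of two
  entries of \<open>A\<close>. The same law, iterated, shows
  \<open>\<tau>\<^sup>n\<^sup>+\<^sup>1(f)(a\<^sup>0, \<dots>, a\<^sup>n) = \<alpha>(f((-)\<^sub>1 \<cdot> a\<^sup>0, \<dots>, (-)\<^sub>n\<^sub>+\<^sub>1 \<cdot> a\<^sup>n))\<close> (\<open>t_power_pure\<close>); by \<open>H\<close>-linearity this is
  \<open>\<alpha>(r\<^sub>m)\<close> for \<open>m = f(a\<^sup>0, \<dots>, a\<^sup>n)\<close>, and stability finishes the argument.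

  The last coface is \<open>\<tau> \<delta>\<^sub>0\<close>, so most relations that involve it follow formally from those
  between \<open>\<tau>\<close> and the remaining operators. What is left (merging neighbours, inserting units) is
  bookkeeping on lists.
\<close>

section \<open>Linear and multilinear maps\<close>

abbreviation klinear where "klinear \<equiv> Vector_Spaces.linear"

lemma klinearI:
  assumes "vector_space sV" "vector_space sW"
    and "\<And>x y. f (x + y) = f x + f y" "\<And>c x. f (sV c x) = sW c (f x)"
  shows "klinear sV sW f"
  using assms by (simp add: Vector_Spaces.linear_iff)

lemma klinear_add: "klinear sV sW f \<Longrightarrow> f (x + y) = f x + f y"
  and klinear_scale: "klinear sV sW f \<Longrightarrow> f (sV c x) = sW c (f x)"
  and klinear_source: "klinear sV sW f \<Longrightarrow> vector_space sV"
  and klinear_target: "klinear sV sW f \<Longrightarrow> vector_space sW"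
  by (simp_all add: Vector_Spaces.linear_iff)

lemma klinear_comp: "klinear sW sU g \<Longrightarrow> klinear sV sW f \<Longrightarrow> klinear sV sU (\<lambda>x. g (f x))"
  by (simp add: Vector_Spaces.linear_iff)

lemma klinear_ident: "vector_space sV \<Longrightarrow> klinear sV sV (\<lambda>x. x)"
  by (simp add: Vector_Spaces.linear_iff)

lemma klinear_zero:
  assumes "klinear sV sW f"
  shows "f 0 = 0"
  using klinear_add[OF assms, of 0 0] by simp

lemma klinear_sum_list:
  assumes "klinear sV sW f"
  shows "f (\<Sum>x\<leftarrow>xs. g x) = (\<Sum>x\<leftarrow>xs. f (g x))"
  by (induction xs) (simp_all add: klinear_zero[OF assms] klinear_add[OF assms])

lemma klinear_scale_const:
  assumes "vector_space sW" "klinear sV sW f"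
  shows "klinear sV sW (\<lambda>x. sW c (f x))"
proof -
  interpret vector_space sW by fact
  from assms show ?thesis
    by (auto simp: Vector_Spaces.linear_iff scale_right_distrib mult.commute)
qed

lemma klinear_scalar:
  assumes "vector_space sW" "klinear sV (*) l"
  shows "klinear sV sW (\<lambda>x. sW (l x) w)"
proof -
  interpret vector_space sW by fact
  from assms show ?thesis
    by (auto simp: Vector_Spaces.linear_iff scale_left_distrib)
qed

lemma klinear_sum_list_param:
  assumes "vector_space sV" "vector_space sW" "\<And>x. x \<in> set xs \<Longrightarrow> klinear sV sW (\<lambda>z. G z x)"
  shows "klinear sV sW (\<lambda>z. \<Sum>x\<leftarrow>xs. G z x)"
proof -
  interpret W: vector_space sW by fact
  show ?thesis
    using assms(3)
  proof (induction xs)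
    case Nil
    then show ?case using assms(1,2) by (auto intro: klinearI)
  next
    case (Cons x xs)
    then show ?case
      by (auto simp: Vector_Spaces.linear_iff W.scale_right_distrib algebra_simps)
  qed
qed

lemma sum_list_map_concat:
  "(\<Sum>x\<leftarrow>concat xss. f x) = (\<Sum>xs\<leftarrow>xss. \<Sum>x\<leftarrow>xs. f x :: 'a::monoid_add)"
  by (induction xss) simp_all

definition bilinear_map where
  "bilinear_map sV sW g \<longleftrightarrow> (\<forall>y. klinear sV sW (\<lambda>x. g x y)) \<and> (\<forall>x. klinear sV sW (\<lambda>y. g x y))"

lemma bilinear_mapI:
  assumes "\<And>y. klinear sV sW (\<lambda>x. g x y)" "\<And>x. klinear sV sW (\<lambda>y. g x y)"
  shows "bilinear_map sV sW g"
  using assms by (simp add: bilinear_map_def)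

lemma multilinear_iff_klinear:
  assumes "vector_space sV" "vector_space sW"
  shows "multilinear sV sW n g \<longleftrightarrow>
    (\<forall>vs i. length vs = n \<longrightarrow> i < n \<longrightarrow> klinear sV sW (\<lambda>x. g (vs[i := x])))"
  using assms unfolding multilinear_def by (auto simp: Vector_Spaces.linear_iff)

lemma multilinearI:
  assumes "vector_space sV" "vector_space sW"
    and "\<And>vs i. length vs = n \<Longrightarrow> i < n \<Longrightarrow> klinear sV sW (\<lambda>x. g (vs[i := x]))"
  shows "multilinear sV sW n g"
  using assms by (simp add: multilinear_iff_klinear)

lemma multilinear_update:
  assumes "vector_space sV" "vector_space sW" "multilinear sV sW n g" "length vs = n" "i < n"
  shows "klinear sV sW (\<lambda>x. g (vs[i := x]))"
  using assms by (simp add: multilinear_iff_klinear)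

lemma multilinear_middle:
  assumes "vector_space sV" "vector_space sW" "multilinear sV sW n g" "Suc (length xs + length ys) = n"
  shows "klinear sV sW (\<lambda>x. g (xs @ x # ys))"
  using multilinear_update[OF assms(1-3), of "xs @ undefined # ys" "length xs"] assms(4) by simp

lemma multilinear_Cons:
  assumes "vector_space sV" "vector_space sW" "multilinear sV sW n g" "Suc (length ys) = n"
  shows "klinear sV sW (\<lambda>x. g (x # ys))"
  using multilinear_middle[OF assms(1-3), of "[]" ys] assms(4) by simp

lemma multilinear_cong:
  assumes "\<And>vs. length vs = n \<Longrightarrow> g vs = g' vs"
  shows "multilinear sV sW n g \<longleftrightarrow> multilinear sV sW n g'"
  unfolding multilinear_def using assms by simp

text \<open>Most operations on argument lists below (merging two neighbours, inserting a unit, acting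
  entrywise) transport a change of one entry to a linear change of one entry; precomposition
  with such an operation preserves multilinearity.\<close>

lemma multilinear_reindex:
  fixes I :: "'v::ab_group_add list \<Rightarrow> 'u::ab_group_add list"
  assumes sp: "vector_space sV" "vector_space sU" "vector_space sW" and g: "multilinear sU sW m g"
    and len: "\<And>vs. length vs = n \<Longrightarrow> length (I vs) = m"
    and upd: "\<And>vs p z. length vs = n \<Longrightarrow> p < n \<Longrightarrow> I (vs[p := z]) = (I vs)[q p := u p vs z]"
    and q: "\<And>p. p < n \<Longrightarrow> q p < m"
    and u: "\<And>p vs. length vs = n \<Longrightarrow> p < n \<Longrightarrow> klinear sV sU (u p vs)"
  shows "multilinear sV sW n (\<lambda>vs. g (I vs))"
proof (rule multilinearI[OF sp(1,3)])
  fix vs :: "'v list" and i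
  assume vs: "length vs = n" "i < n"
  have "klinear sV sW (\<lambda>x. g ((I vs)[q i := u i vs x]))"
    by (rule klinear_comp[OF multilinear_update[OF sp(2,3) g len[OF vs(1)] q[OF vs(2)]] u[OF vs]])
  then show "klinear sV sW (\<lambda>x. g (I (vs[i := x])))"
    using upd[OF vs] by simp
qed

lemma bilinear_map_two_entries:
  assumes "vector_space sV" "vector_space sW" "multilinear sV sW (Suc n) g"
    "Suc (length us + length ws) = n"
  shows "bilinear_map sV sW (\<lambda>x y. g (us @ x # y # ws))"
proof (rule bilinear_mapI)
  show "klinear sV sW (\<lambda>x. g (us @ x # y # ws))" for y
    using multilinear_middle[OF assms(1-3), of us "y # ws"] assms(4) by simp
  show "klinear sV sW (\<lambda>y. g (us @ x # y # ws))" for x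
    using multilinear_middle[OF assms(1-3), of "us @ [x]" ws] assms(4) by simp
qed


section \<open>Tensors as finite sums of pure tensors\<close>

text \<open>A positive number of factors lets scalars be absorbed, so that sums suffice and linear
  combinations are avoided. In tensor power zero there is no factor to absorb them.\<close>

lemma tensor_power_sum_pure:
  fixes sV :: "'k::field \<Rightarrow> 'v::ab_group_add \<Rightarrow> 'v"
  assumes "t \<in> tensor_power sV (Suc n)"
  shows "\<exists>vss. (\<forall>vs\<in>set vss. length vs = Suc n) \<and> t = (\<Sum>vs\<leftarrow>vss. pure_tensor sV vs)"
  using assms
proof (induction rule: tensor_power_induct)
  case zero
  show ?case by (rule exI[of _ "[]"]) simp
next
  case (pure vs)
  then show ?case by (intro exI[of _ "[vs]"]) simp
next
  case (add s t)
  then obtain vss wss where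
    "\<forall>vs\<in>set vss. length vs = Suc n" "s = (\<Sum>vs\<leftarrow>vss. pure_tensor sV vs)"
    "\<forall>vs\<in>set wss. length vs = Suc n" "t = (\<Sum>vs\<leftarrow>wss. pure_tensor sV vs)" by blast
  then show ?case by (intro exI[of _ "vss @ wss"]) auto
next
  case (scale c t)
  then obtain vss where vss: "\<forall>vs\<in>set vss. length vs = Suc n"
    "t = (\<Sum>vs\<leftarrow>vss. pure_tensor sV vs)" by blast
  have T: "vector_space (tscale :: 'k \<Rightarrow> ('k, 'v) tensor \<Rightarrow> _)" by (rule vector_space_tscale)
  have cp: "tscale c (pure_tensor sV vs) = pure_tensor sV (vs[0 := sV c (vs ! 0)])"
    if "length vs = Suc n" for vs
    using multilinearD(2)[OF multilinear_pure that, of 0 sV c "vs ! 0"] by simp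
  have "tscale c t = (\<Sum>vs\<leftarrow>vss. tscale c (pure_tensor sV vs))"
    unfolding vss(2) by (rule klinear_sum_list[OF klinear_scale_const[OF T klinear_ident[OF T]]])
  also have "\<dots> = (\<Sum>vs\<leftarrow>map (\<lambda>vs. vs[0 := sV c (vs ! 0)]) vss. pure_tensor sV vs)"
    using vss(1) by (auto simp: cp o_def intro!: arg_cong[where f = sum_list])
  finally show ?case using vss(1) by (intro exI[of _ "map (\<lambda>vs. vs[0 := sV c (vs ! 0)]) vss"]) auto
qed

lemma zero_in_tensor_power: "0 \<in> tensor_power (sV :: 'k::field \<Rightarrow> 'v::ab_group_add \<Rightarrow> 'v) n"
  by (rule module.subspace_0[OF _ tensor_power_subspace])
    (auto intro: vector_space_tscale simp: module_iff_vector_space)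

lemma sum_pure_in_tensor_power:
  assumes "\<forall>vs\<in>set vss. length vs = n"
  shows "(\<Sum>vs\<leftarrow>vss. pure_tensor sV vs) \<in> tensor_power sV n"
  using assms
  by (induction vss) (auto intro: zero_in_tensor_power tensor_power_add pure_in_tensor_power)

lemma tensor_hom_add:
  assumes "f \<in> tensor_hom sV n sW" "s \<in> tensor_power sV n" "t \<in> tensor_power sV n"
  shows "f (s + t) = f s + f t"
  using assms by (simp add: tensor_hom_def linear_on_def)

lemma tensor_hom_scale:
  assumes "f \<in> tensor_hom sV n sW" "t \<in> tensor_power sV n"
  shows "f (tscale c t) = sW c (f t)"
  using assms by (simp add: tensor_hom_def linear_on_def)

lemma tensor_hom_zero:
  fixes sV :: "'k::field \<Rightarrow> 'v::ab_group_add \<Rightarrow> 'v"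
  assumes "f \<in> tensor_hom sV n sW"
  shows "f 0 = 0"
  using tensor_hom_add[OF assms zero_in_tensor_power zero_in_tensor_power]
  by (metis add.right_neutral add_cancel_right_right)

lemma tensor_hom_sum_pure:
  assumes "f \<in> tensor_hom sV n sW" "\<forall>vs\<in>set vss. length vs = n"
  shows "f (\<Sum>vs\<leftarrow>vss. pure_tensor sV vs) = (\<Sum>vs\<leftarrow>vss. f (pure_tensor sV vs))"
  using assms(2)
proof (induction vss)
  case Nil
  then show ?case using tensor_hom_zero[OF assms(1)] by (metis list.map(1) sum_list.Nil)
next
  case (Cons vs vss)
  then have "f (pure_tensor sV vs + (\<Sum>vs\<leftarrow>vss. pure_tensor sV vs))
      = f (pure_tensor sV vs) + f (\<Sum>vs\<leftarrow>vss. pure_tensor sV vs)"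
    by (intro tensor_hom_add[OF assms(1) pure_in_tensor_power sum_pure_in_tensor_power]) auto
  moreover have "f (\<Sum>vs\<leftarrow>vss. pure_tensor sV vs) = (\<Sum>vs\<leftarrow>vss. f (pure_tensor sV vs))"
    using Cons.prems by (intro Cons.IH) auto
  ultimately show ?case by (simp only: list.map sum_list.Cons)
qed

lemma tensor_hom_multilinear:
  "f \<in> tensor_hom sV n sW \<Longrightarrow> multilinear sV sW n (\<lambda>vs. f (pure_tensor sV vs))"
  by (rule multilinear_compose) (simp add: tensor_hom_def)

lemma tensor_hom_eqI:
  fixes sV :: "'k::field \<Rightarrow> 'v::ab_group_add \<Rightarrow> 'v"
  assumes W: "vector_space sW" and f: "f \<in> tensor_hom sV n sW" and g: "g \<in> tensor_hom sV n sW"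
    and eq: "\<And>vs. length vs = n \<Longrightarrow> f (pure_tensor sV vs) = g (pure_tensor sV vs)"
  shows "f = g"
  using tensor_universal_property[OF W tensor_hom_multilinear[OF f]] f g eq by auto

lemma tensor_lift_cong:
  assumes "\<And>vs. length vs = n \<Longrightarrow> g vs = g' vs"
  shows "tensor_lift sV sW n g = tensor_lift sV sW n g'"
  unfolding tensor_lift_def using assms by (intro arg_cong[where f = The] ext) auto

lemma tensor_lift_sum_pure:
  assumes "vector_space sW" "multilinear sV sW n g" "\<forall>vs\<in>set vss. length vs = n"
  shows "tensor_lift sV sW n g (\<Sum>vs\<leftarrow>vss. pure_tensor sV vs) = (\<Sum>vs\<leftarrow>vss. g vs)"
  using tensor_hom_sum_pure[OF tensor_lift_hom[OF assms(1,2)] assms(3)] assms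
  by (auto simp: tensor_lift_pure intro!: arg_cong[where f = sum_list])

lemma tensor_hom_subspace:
  fixes sV :: "'k::field \<Rightarrow> 'v::ab_group_add \<Rightarrow> 'v"
  assumes "vector_space sW"
  shows "module.subspace (scale_fun sW) (tensor_hom sV n sW)"
proof -
  interpret W: vector_space sW by fact
  interpret F: vector_space "scale_fun sW :: _ \<Rightarrow> (('k, 'v) tensor \<Rightarrow> _) \<Rightarrow> _"
    by (rule vector_space_scale_fun[OF assms])
  show ?thesis
    by (rule F.subspaceI)
      (auto simp: tensor_hom_def linear_on_def scale_fun_def W.scale_right_distrib mult.commute algebra_simps)
qed


section \<open>Sweedler sums\<close>

context k_coalgebra
begin

text \<open>Choosing one expression of each \<open>\<Delta> c\<close> as a sum of pure tensors turns a Sweedler expression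
  into an honest finite sum, defined for every \<open>g\<close>. Only for bilinear \<open>g\<close> is it independent of
  the choice.\<close>

definition comult_terms :: "'c \<Rightarrow> ('c \<times> 'c) list" where
  "comult_terms c = (SOME ps. \<Delta> c = (\<Sum>p\<leftarrow>ps. pure_tensor scale [fst p, snd p]))"

definition sweedler :: "('c \<Rightarrow> 'c \<Rightarrow> 'w::ab_group_add) \<Rightarrow> 'c \<Rightarrow> 'w" where
  "sweedler g c = (\<Sum>p\<leftarrow>comult_terms c. g (fst p) (snd p))"

lemma comult_eq_sum: "\<Delta> c = (\<Sum>p\<leftarrow>comult_terms c. pure_tensor scale [fst p, snd p])"
proof -
  obtain vss where vss: "\<forall>vs\<in>set vss. length vs = Suc 1" "\<Delta> c = (\<Sum>vs\<leftarrow>vss. pure_tensor scale vs)"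
    using tensor_power_sum_pure[of "\<Delta> c" scale 1] comult_in[of c] by (auto simp: numeral_2_eq_2)
  have "[vs ! 0, vs ! 1] = vs" if "vs \<in> set vss" for vs
    using vss(1) that by (auto simp: length_Suc_conv)
  then have "\<Delta> c = (\<Sum>p\<leftarrow>map (\<lambda>vs. (vs ! 0, vs ! 1)) vss. pure_tensor scale [fst p, snd p])"
    unfolding vss(2) by (auto simp: o_def intro!: arg_cong[where f = sum_list])
  then show ?thesis unfolding comult_terms_def by (rule someI)
qed

lemma multilinear_of_bilinear:
  assumes "bilinear_map scale sW g"
  shows "multilinear scale sW 2 (\<lambda>vs. g (vs ! 0) (vs ! 1))"
  using assms
  by (auto simp: multilinear_def bilinear_map_def Vector_Spaces.linear_iff less_2_cases_iff)

lemma lift2_comult: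
  assumes "vector_space sW" "bilinear_map scale sW g"
  shows "lift2 scale sW g (\<Delta> c) = sweedler g c"
proof -
  have "\<Delta> c = (\<Sum>vs\<leftarrow>map (\<lambda>p. [fst p, snd p]) (comult_terms c). pure_tensor scale vs)"
    by (subst comult_eq_sum) (simp add: o_def)
  then show ?thesis
    unfolding lift2_def sweedler_def
    using tensor_lift_sum_pure[OF assms(1) multilinear_of_bilinear[OF assms(2)],
        of "map (\<lambda>p. [fst p, snd p]) (comult_terms c)"]
    by (simp add: o_def)
qed

lemma klinear_sweedler_apply:
  assumes "klinear sV sW f"
  shows "f (sweedler g c) = sweedler (\<lambda>x y. f (g x y)) c"
  unfolding sweedler_def by (rule klinear_sum_list[OF assms])

lemma klinear_sweedler_param:
  assumes "\<And>x y. klinear sV sW (\<lambda>z. G z x y)"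
  shows "klinear sV sW (\<lambda>z. sweedler (G z) c)"
  unfolding sweedler_def
  using assms klinear_source[OF assms] klinear_target[OF assms] by (intro klinear_sum_list_param)

text \<open>The chosen terms need not depend linearly on the element. For bilinear \<open>g\<close> their sum does,
  because it is the value of a linear map at the coproduct.\<close>

lemma klinear_sweedler:
  assumes "vector_space sW" "bilinear_map scale sW g"
  shows "klinear scale sW (sweedler g)"
proof (rule klinearI[OF vector_space_axioms assms(1)])
  have hom: "lift2 scale sW g \<in> tensor_hom scale 2 sW"
    unfolding lift2_def by (rule tensor_lift_hom[OF assms(1) multilinear_of_bilinear[OF assms(2)]])
  show "sweedler g (x + y) = sweedler g x + sweedler g y" for x y
    unfolding lift2_comult[OF assms, symmetric] klinear_add[OF comult_linear]
    by (rule tensor_hom_add[OF hom comult_in comult_in])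
  show "sweedler g (scale c x) = sW c (sweedler g x)" for c x
    unfolding lift2_comult[OF assms, symmetric] klinear_scale[OF comult_linear]
    by (rule tensor_hom_scale[OF hom comult_in])
qed

text \<open>Coassociativity is an equation in the third tensor power; the lift of the trilinear \<open>g\<close>
  transports it to sums of values of \<open>g\<close>.\<close>

lemma sweedler_coassoc:
  assumes W: "vector_space sW"
    and g: "\<And>y z. klinear scale sW (\<lambda>x. g x y z)" "\<And>x z. klinear scale sW (\<lambda>y. g x y z)"
      "\<And>x y. klinear scale sW (\<lambda>z. g x y z)"
  shows "sweedler (\<lambda>u z. sweedler (\<lambda>x y. g x y z) u) c = sweedler (\<lambda>x v. sweedler (\<lambda>y z. g x y z) v) c"
proof -
  let ?p = "pure_tensor scale" and ?g = "\<lambda>vs. g (vs ! 0) (vs ! 1) (vs ! 2)"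
  note V = vector_space_axioms
  have T: "vector_space (tscale :: 'k \<Rightarrow> ('k, 'c) tensor \<Rightarrow> _)" by (rule vector_space_tscale)
  have p: "klinear scale tscale (\<lambda>x. ?p [x, y, z])" "klinear scale tscale (\<lambda>x. ?p [y, x, z])"
    "klinear scale tscale (\<lambda>x. ?p [y, z, x])" for y z
    using multilinear_middle[OF V T multilinear_pure, of "[]" "[y, z]"]
      multilinear_middle[OF V T multilinear_pure, of "[y]" "[z]"]
      multilinear_middle[OF V T multilinear_pure, of "[y, z]" "[]"] by simp_all
  have b1: "bilinear_map scale tscale (\<lambda>x y. ?p [x, y, z])" for z
    by (intro bilinear_mapI p)
  have b2: "bilinear_map scale tscale (\<lambda>y z. ?p [x, y, z])" for x
    by (intro bilinear_mapI p)
  have b3: "bilinear_map scale tscale (\<lambda>u z. sweedler (\<lambda>x y. ?p [x, y, z]) u)"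
    by (intro bilinear_mapI klinear_sweedler T b1 klinear_sweedler_param p)
  have b4: "bilinear_map scale tscale (\<lambda>x v. sweedler (\<lambda>y z. ?p [x, y, z]) v)"
    by (intro bilinear_mapI klinear_sweedler T b2 klinear_sweedler_param p)
  have eq: "sweedler (\<lambda>u z. sweedler (\<lambda>x y. ?p [x, y, z]) u) c = sweedler (\<lambda>x v. sweedler (\<lambda>y z. ?p [x, y, z]) v) c"
    using coassoc[of c]
    by (simp only: lift2_comult[OF T b1] lift2_comult[OF T b2] lift2_comult[OF T b3] lift2_comult[OF T b4])
  have m: "multilinear scale sW 3 ?g"
    using g by (auto simp: multilinear_def Vector_Spaces.linear_iff less_Suc_eq numeral_3_eq_3 numeral_2_eq_2)
  have L: "tensor_lift scale sW 3 ?g (\<Sum>p\<leftarrow>ps. \<Sum>q\<leftarrow>Q p. ?p [F p q, G p q, H p q])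
    = (\<Sum>p\<leftarrow>ps. \<Sum>q\<leftarrow>Q p. g (F p q) (G p q) (H p q))"
    for ps :: "('c \<times> 'c) list" and Q :: "'c \<times> 'c \<Rightarrow> ('c \<times> 'c) list" and F G H
    using tensor_lift_sum_pure[OF W m,
        of "concat (map (\<lambda>p. map (\<lambda>q. [F p q, G p q, H p q]) (Q p)) ps)"]
    by (simp add: sum_list_map_concat o_def numeral_2_eq_2)
  show ?thesis
    using arg_cong[OF eq, of "tensor_lift scale sW 3 ?g"] unfolding sweedler_def L .
qed

lemma sweedler_counit_left:
  assumes "klinear scale sW f"
  shows "sweedler (\<lambda>x y. sW (\<epsilon> x) (f y)) c = f c"
proof -
  note V = vector_space_axioms
  have b: "bilinear_map scale scale (\<lambda>x y. scale (\<epsilon> x) y)"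
    by (intro bilinear_mapI klinear_scalar klinear_scale_const klinear_ident V counit_linear)
  have "f c = f (sweedler (\<lambda>x y. scale (\<epsilon> x) y) c)"
    using counit_left[of c] by (simp only: lift2_comult[OF V b])
  then show ?thesis by (simp add: klinear_sweedler_apply[OF assms] klinear_scale[OF assms])
qed

lemma sweedler_counit_right:
  assumes "klinear scale sW f"
  shows "sweedler (\<lambda>x y. sW (\<epsilon> y) (f x)) c = f c"
proof -
  note V = vector_space_axioms
  have b: "bilinear_map scale scale (\<lambda>x y. scale (\<epsilon> y) x)"
    by (intro bilinear_mapI klinear_scalar klinear_scale_const klinear_ident V counit_linear)
  have "f c = f (sweedler (\<lambda>x y. scale (\<epsilon> y) x) c)"
    using counit_right[of c] by (simp only: lift2_comult[OF V b])
  then show ?thesis by (simp add: klinear_sweedler_apply[OF assms] klinear_scale[OF assms])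
qed

primrec iter_comult_terms :: "nat \<Rightarrow> 'c \<Rightarrow> 'c list list" where
  "iter_comult_terms 0 c = [[c]]"
| "iter_comult_terms (Suc n) c =
     concat (map (\<lambda>vs. map (\<lambda>p. fst p # snd p # tl vs) (comult_terms (hd vs))) (iter_comult_terms n c))"

text \<open>The Sweedler expression \<open>g(c\<^sub>1, \<dots>, c\<^sub>n\<^sub>+\<^sub>1)\<close>.\<close>

definition sweedlers :: "nat \<Rightarrow> ('c list \<Rightarrow> 'w::ab_group_add) \<Rightarrow> 'c \<Rightarrow> 'w" where
  "sweedlers n g c = (\<Sum>vs\<leftarrow>iter_comult_terms n c. g vs)"

text \<open>The form \<open>g\<close> precomposed with \<open>\<Delta>\<close> applied to the tensor factor at position \<open>i\<close>.\<close>

definition split_entry :: "nat \<Rightarrow> ('c list \<Rightarrow> 'w::ab_group_add) \<Rightarrow> 'c list \<Rightarrow> 'w" where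
  "split_entry i g vs = sweedler (\<lambda>x y. g (take i vs @ x # y # drop (Suc i) vs)) (vs ! i)"

lemma length_iter_comult_terms: "vs \<in> set (iter_comult_terms n c) \<Longrightarrow> length vs = Suc n"
  by (induction n arbitrary: vs) auto

lemma sweedlers_cong:
  assumes "\<And>vs. length vs = Suc n \<Longrightarrow> g vs = g' vs"
  shows "sweedlers n g c = sweedlers n g' c"
  unfolding sweedlers_def using assms length_iter_comult_terms
  by (intro arg_cong[where f = sum_list] map_cong) auto

lemma sweedlers_0: "sweedlers 0 g c = g [c]"
  by (simp add: sweedlers_def)

lemma sweedlers_Suc: "sweedlers (Suc n) g c = sweedlers n (split_entry 0 g) c"
proof -
  have "sweedlers (Suc n) g c = sweedlers n (\<lambda>vs. sweedler (\<lambda>x y. g (x # y # tl vs)) (hd vs)) c"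
    by (simp add: sweedlers_def sweedler_def sum_list_map_concat o_def)
  also have "\<dots> = sweedlers n (split_entry 0 g) c"
    by (rule sweedlers_cong) (auto simp: split_entry_def length_Suc_conv)
  finally show ?thesis .
qed

lemma klinear_sweedlers_param:
  assumes "vector_space sV" "vector_space sW"
    "\<And>vs. length vs = Suc n \<Longrightarrow> klinear sV sW (\<lambda>z. G z vs)"
  shows "klinear sV sW (\<lambda>z. sweedlers n (G z) c)"
  unfolding sweedlers_def
  by (rule klinear_sum_list_param[OF assms(1,2)]) (use assms(3) length_iter_comult_terms in blast)

lemma bilinear_split:
  assumes "vector_space sW" "multilinear scale sW (Suc (Suc n)) g" "length vs = Suc n" "i \<le> n"
  shows "bilinear_map scale sW (\<lambda>x y. g (take i vs @ x # y # drop (Suc i) vs))"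
  using bilinear_map_two_entries[OF vector_space_axioms assms(1,2), of "take i vs" "drop (Suc i) vs"] assms(3,4)
  by simp

lemma multilinear_split_entry:
  assumes W: "vector_space sW" and g: "multilinear scale sW (Suc (Suc n)) g" and i: "i \<le> n"
  shows "multilinear scale sW (Suc n) (split_entry i g)"
proof (rule multilinearI[OF vector_space_axioms W])
  fix vs :: "'c list" and p
  assume vs: "length vs = Suc n" and p: "p < Suc n"
  show "klinear scale sW (\<lambda>z. split_entry i g (vs[p := z]))"
  proof (cases "p = i")
    case True
    then show ?thesis
      using klinear_sweedler[OF W bilinear_split[OF W g vs i]] vs p
      by (simp add: split_entry_def)
  next
    case False
    have "take i (vs[p := z]) @ x # y # drop (Suc i) (vs[p := z]) =
        (take i vs @ x # y # drop (Suc i) vs)[if p < i then p else Suc p := z]" for x y z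
      using vs p i False
      by (intro nth_equalityI) (auto simp: nth_append nth_list_update nth_Cons split: nat.splits)
    then have "split_entry i g (vs[p := z]) = sweedler (\<lambda>x y.
        g ((take i vs @ x # y # drop (Suc i) vs)[if p < i then p else Suc p := z])) (vs ! i)" for z
      using False by (simp add: split_entry_def)
    moreover have "klinear scale sW (\<lambda>z. sweedler (\<lambda>x y.
        g ((take i vs @ x # y # drop (Suc i) vs)[if p < i then p else Suc p := z])) (vs ! i))"
      using vs p i
      by (intro klinear_sweedler_param multilinear_update[OF vector_space_axioms W g]) auto
    ultimately show ?thesis by simp
  qed
qed

text \<open>With all other entries held fixed, \<open>g\<close> is a trilinear form in the three factors that arise
  from entry \<open>i\<close>, so coassociativity applies to it.\<close>

lemma split_entry_coassoc:
  assumes W: "vector_space sW" and g: "multilinear scale sW (Suc (Suc (Suc n))) g" and i: "i \<le> n"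
    and vs: "length vs = Suc n"
  shows "split_entry i (split_entry (Suc i) g) vs = split_entry i (split_entry i g) vs"
proof -
  let ?G = "\<lambda>x y z. g (take i vs @ x # y # z # drop (Suc i) vs)"
  have len: "length (take i vs) = i" using vs i by simp
  have tri: "klinear scale sW (\<lambda>x. ?G x y z)" "klinear scale sW (\<lambda>x. ?G y x z)"
    "klinear scale sW (\<lambda>x. ?G y z x)" for y z
    using multilinear_middle[OF vector_space_axioms W g, of "take i vs" "y # z # drop (Suc i) vs"]
      multilinear_middle[OF vector_space_axioms W g, of "take i vs @ [y]" "z # drop (Suc i) vs"]
      multilinear_middle[OF vector_space_axioms W g, of "take i vs @ [y, z]" "drop (Suc i) vs"] vs i
    by simp_all
  have "split_entry i (split_entry (Suc i) g) vs = sweedler (\<lambda>x v. sweedler (\<lambda>y z. ?G x y z) v) (vs ! i)"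
    using len by (simp add: split_entry_def nth_append)
  also have "\<dots> = sweedler (\<lambda>u z. sweedler (\<lambda>x y. ?G x y z) u) (vs ! i)"
    by (rule sweedler_coassoc[OF W tri, symmetric])
  also have "\<dots> = split_entry i (split_entry i g) vs"
    using len by (simp add: split_entry_def nth_append)
  finally show ?thesis .
qed

text \<open>Generalised coassociativity: \<open>\<Delta>\<close> may be applied to any tensor factor, not only to the first.
  Splitting factor \<open>i + 1\<close> after factor \<open>i\<close> is by coassociativity the same as splitting factor \<open>i\<close>
  twice, so the position moves one step to the left.\<close>

lemma sweedlers_split_entry:
  assumes W: "vector_space sW"
  shows "multilinear scale sW (Suc (Suc n)) g \<Longrightarrow> i \<le> n \<Longrightarrow>
    sweedlers (Suc n) g c = sweedlers n (split_entry i g) c"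
proof (induction n arbitrary: g i)
  case 0
  then show ?case by (simp add: sweedlers_Suc)
next
  case (Suc n)
  note IH = Suc.IH and g = Suc.prems(1) and ms = multilinear_split_entry[OF W Suc.prems(1)]
  show ?case
    using Suc.prems(2)
  proof (induction i)
    case 0
    show ?case by (rule sweedlers_Suc)
  next
    case (Suc i)
    then have i: "i \<le> n" "i \<le> Suc n" "Suc i \<le> Suc n" by simp_all
    have "sweedlers (Suc n) (split_entry (Suc i) g) c
        = sweedlers n (split_entry i (split_entry (Suc i) g)) c"
      by (rule IH[OF ms[OF i(3)] i(1)]) 
    also have "\<dots> = sweedlers n (split_entry i (split_entry i g)) c"
      by (intro sweedlers_cong split_entry_coassoc[OF W g i(1)])
    also have "\<dots> = sweedlers (Suc n) (split_entry i g) c"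
      by (rule IH[OF ms[OF i(2)] i(1), symmetric])
    also have "\<dots> = sweedlers (Suc (Suc n)) g c"
      using Suc.IH i by simp
    finally show ?case by simp
  qed
qed

lemma klinear_sweedlers:
  assumes W: "vector_space sW"
  shows "multilinear scale sW (Suc n) g \<Longrightarrow> klinear scale sW (sweedlers n g)"
proof (induction n arbitrary: g)
  case 0
  have "klinear scale sW (\<lambda>x. g [x])"
    using multilinear_middle[OF vector_space_axioms W 0, of "[]" "[]"] by simp
  then show ?case by (simp add: sweedlers_0[abs_def])
next
  case (Suc n)
  then show ?case
    using multilinear_split_entry[OF W Suc.prems, of 0] by (simp add: sweedlers_Suc[abs_def])
qed

text \<open>Since any factor may be split, the last \<open>n\<close> of \<open>m + n\<close> comultiplications may all take
  place inside factor \<open>i\<close> of an \<open>m\<close>-fold one.\<close>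

lemma sweedlers_nested:
  assumes W: "vector_space sW"
  shows "multilinear scale sW (Suc (m + n)) g \<Longrightarrow> i \<le> m \<Longrightarrow>
    sweedlers (m + n) g c =
    sweedlers m (\<lambda>vs. sweedlers n (\<lambda>ks. g (take i vs @ ks @ drop (Suc i) vs)) (vs ! i)) c"
proof (induction n arbitrary: g)
  case 0
  have "g vs = g (take i vs @ [vs ! i] @ drop (Suc i) vs)" if "length vs = Suc m" for vs
    using that 0 by (simp add: id_take_nth_drop[symmetric])
  then show ?case by (auto simp: sweedlers_0 intro!: sweedlers_cong)
next
  case (Suc n)
  have i: "i \<le> m + n" using Suc.prems by simp
  have "sweedlers (m + Suc n) g c = sweedlers (m + n) (split_entry i g) c"
    using sweedlers_split_entry[OF W _ i] Suc.prems by simp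
  also have "\<dots> = sweedlers m
      (\<lambda>vs. sweedlers n (\<lambda>ks. split_entry i g (take i vs @ ks @ drop (Suc i) vs)) (vs ! i)) c"
    using multilinear_split_entry[OF W _ i] Suc by simp
  also have "\<dots> = sweedlers m
      (\<lambda>vs. sweedlers (Suc n) (\<lambda>ks. g (take i vs @ ks @ drop (Suc i) vs)) (vs ! i)) c"
  proof (rule sweedlers_cong)
    fix vs :: "'c list"
    assume vs: "length vs = Suc m"
    have "split_entry i g (take i vs @ ks @ drop (Suc i) vs)
        = split_entry 0 (\<lambda>ks. g (take i vs @ ks @ drop (Suc i) vs)) ks" if "length ks = Suc n" for ks
      using that vs Suc.prems(2) by (auto simp: split_entry_def length_Suc_conv nth_append)
    then show "sweedlers n (\<lambda>ks. split_entry i g (take i vs @ ks @ drop (Suc i) vs)) (vs ! i)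
        = sweedlers (Suc n) (\<lambda>ks. g (take i vs @ ks @ drop (Suc i) vs)) (vs ! i)"
      unfolding sweedlers_Suc by (rule sweedlers_cong)
  qed
  finally show ?case .
qed

lemma iter_comult_eq_sum:
  "iter_comult scale \<Delta> n c = (\<Sum>vs\<leftarrow>iter_comult_terms n c. pure_tensor scale vs)"
proof (induction n)
  case 0
  show ?case by simp
next
  case (Suc n)
  note V = vector_space_axioms
  have T: "vector_space (tscale :: 'k \<Rightarrow> ('k, 'c) tensor \<Rightarrow> _)" by (rule vector_space_tscale)
  have b: "bilinear_map scale tscale (\<lambda>x y. pure_tensor scale (x # y # ys))" for ys
    using bilinear_map_two_entries[OF V T multilinear_pure, of "[]" ys] by simp
  let ?G = "\<lambda>vs. sweedler (\<lambda>x y. pure_tensor scale (x # y # tl vs)) (hd vs)"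
  have "multilinear scale tscale (Suc n) ?G \<longleftrightarrow> multilinear scale tscale (Suc n) (split_entry 0 (pure_tensor scale))"
    by (rule multilinear_cong) (auto simp: split_entry_def length_Suc_conv)
  then have m: "multilinear scale tscale (Suc n) ?G"
    using multilinear_split_entry[OF T multilinear_pure, of 0 n] by simp
  have "iter_comult scale \<Delta> (Suc n) c = (\<Sum>vs\<leftarrow>iter_comult_terms n c. ?G vs)"
    unfolding iter_comult.simps Suc lift2_comult[OF T b]
    by (rule tensor_lift_sum_pure[OF T m]) (simp add: length_iter_comult_terms)
  then show ?case by (simp add: sweedler_def sum_list_map_concat o_def)
qed

lemma tensor_lift_iter_comult:
  assumes "vector_space sW" "multilinear scale sW (Suc n) g"
  shows "tensor_lift scale sW (Suc n) g (iter_comult scale \<Delta> n c) = sweedlers n g c"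
  unfolding iter_comult_eq_sum sweedlers_def
  by (rule tensor_lift_sum_pure[OF assms]) (simp add: length_iter_comult_terms)

end

section \<open>The antipode\<close>

lemma sum_list_exchange:
  "(\<Sum>x\<leftarrow>xs. \<Sum>y\<leftarrow>ys. f x y :: 'a::comm_monoid_add) = (\<Sum>y\<leftarrow>ys. \<Sum>x\<leftarrow>xs. f x y)"
  by (induction xs) (simp_all add: sum_list_addf)

lemma (in k_coalgebra) sweedler_exchange:
  "sweedler (\<lambda>x y. sweedler (\<lambda>u v. g x y u v) b) a = sweedler (\<lambda>u v. sweedler (\<lambda>x y. g x y u v) a) b"
  unfolding sweedler_def by (rule sum_list_exchange)

lemma (in k_algebra) klinear_mult_left: "klinear sV scale f \<Longrightarrow> klinear sV scale (\<lambda>x. f x * c)"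
  by (auto simp: Vector_Spaces.linear_iff distrib_right scale_mult_left)

lemma (in k_algebra) klinear_mult_right: "klinear sV scale f \<Longrightarrow> klinear sV scale (\<lambda>x. c * f x)"
  by (auto simp: Vector_Spaces.linear_iff distrib_left scale_mult_right)

lemma (in k_bialgebra) sweedler_mult:
  assumes W: "vector_space sW" and g: "bilinear_map scale sW g"
  shows "sweedler g (a * b) = sweedler (\<lambda>a1 a2. sweedler (\<lambda>b1 b2. g (a1 * b1) (a2 * b2)) b) a"
proof -
  let ?p = "pure_tensor scale" and ?g = "\<lambda>vs. g (vs ! 0) (vs ! 1)"
  note V = vector_space_axioms
  have T: "vector_space (tscale :: 'k \<Rightarrow> ('k, 'h) tensor \<Rightarrow> _)" by (rule vector_space_tscale)
  have p: "klinear scale tscale (\<lambda>x. ?p [x, y])" "klinear scale tscale (\<lambda>x. ?p [y, x])" for y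
    using multilinear_middle[OF V T multilinear_pure, of "[]" "[y]"]
      multilinear_middle[OF V T multilinear_pure, of "[y]" "[]"] by simp_all
  have b1: "bilinear_map scale tscale (\<lambda>y1 y2. ?p [x1 * y1, x2 * y2])" for x1 x2
    by (intro bilinear_mapI klinear_comp[OF p(1)] klinear_comp[OF p(2)]
        klinear_mult_right klinear_ident V)
  have b2: "bilinear_map scale tscale (\<lambda>x1 x2. sweedler (\<lambda>y1 y2. ?p [x1 * y1, x2 * y2]) b)"
    by (intro bilinear_mapI klinear_sweedler_param klinear_comp[OF p(1)] klinear_comp[OF p(2)]
        klinear_mult_left klinear_ident V)
  have eq: "\<Delta> (a * b) = sweedler (\<lambda>x1 x2. sweedler (\<lambda>y1 y2. ?p [x1 * y1, x2 * y2]) b) a"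
    using comult_mult[of a b] by (simp only: lift2_comult[OF T b1] lift2_comult[OF T b2])
  have L: "lift2 scale sW g (\<Sum>p\<leftarrow>ps. \<Sum>q\<leftarrow>qs. ?p [F p q, G p q])
    = (\<Sum>p\<leftarrow>ps. \<Sum>q\<leftarrow>qs. g (F p q) (G p q))"
    for ps qs :: "('h \<times> 'h) list" and F G
    using tensor_lift_sum_pure[OF W multilinear_of_bilinear[OF g],
        of "concat (map (\<lambda>p. map (\<lambda>q. [F p q, G p q]) qs) ps)"]
    by (simp add: lift2_def sum_list_map_concat o_def)
  have "sweedler g (a * b) = lift2 scale sW g (\<Delta> (a * b))"
    by (rule lift2_comult[OF W g, symmetric])
  then show ?thesis
    unfolding eq sweedler_def L .
qed

context hopf_algebra
begin

lemma klinear_antipode: "klinear sV scale f \<Longrightarrow> klinear sV scale (\<lambda>x. S (f x))"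
  by (rule klinear_comp[OF antipode_linear])

lemmas antipode_klinear_intros =
  klinear_antipode klinear_mult_left klinear_mult_right klinear_ident vector_space_axioms

lemma sweedler_antipode_left: "sweedler (\<lambda>x y. S x * y) h = scale (\<epsilon> h) 1"
  by (subst antipode_left[symmetric], rule lift2_comult[symmetric])
    (intro bilinear_mapI antipode_klinear_intros)+

lemma sweedler_antipode_right: "sweedler (\<lambda>x y. x * S y) h = scale (\<epsilon> h) 1"
  by (subst antipode_right[symmetric], rule lift2_comult[symmetric])
    (intro bilinear_mapI antipode_klinear_intros)+

text \<open>Both sides are convolution inverses of the multiplication \<open>H \<otimes> H \<rightarrow> H\<close>: the expression
  \<open>S(a\<^sub>1 b\<^sub>1) a\<^sub>2 b\<^sub>2 S(b\<^sub>3) S(a\<^sub>3)\<close> collapses to \<open>S(a b)\<close> from the right and to \<open>S(b) S(a)\<close> from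
  the left.\<close>

lemma antipode_antimult: "S (a * b) = S b * S a"
proof -
  note V = vector_space_axioms
  note lin = antipode_klinear_intros klinear_sweedler_param
  let ?Y = "\<lambda>a1 a2 a3 b1 b2 b3. S (a1 * b1) * (a2 * (b2 * S b3) * S a3)"
  have right: "sweedler (\<lambda>a2 a3. sweedler (\<lambda>b2 b3. ?Y a1 a2 a3 b1 b2 b3) b') a'
      = scale (\<epsilon> a') (scale (\<epsilon> b') (S (a1 * b1)))" for a1 a' b1 b'
  proof -
    have "sweedler (\<lambda>b2 b3. ?Y a1 a2 a3 b1 b2 b3) b' = scale (\<epsilon> b') (S (a1 * b1) * (a2 * S a3))" for a2 a3
    proof -
      have "klinear scale scale (\<lambda>z. S (a1 * b1) * (a2 * z * S a3))" by (intro lin)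
      from klinear_sweedler_apply[OF this, of "\<lambda>b2 b3. b2 * S b3" b', symmetric]
      show ?thesis by (simp add: sweedler_antipode_right scale_mult_left scale_mult_right)
    qed
    moreover have "klinear scale scale (\<lambda>z. scale (\<epsilon> b') (S (a1 * b1) * z))"
      by (intro klinear_scale_const lin)
    from klinear_sweedler_apply[OF this, of "\<lambda>a2 a3. a2 * S a3" a', symmetric]
    have "sweedler (\<lambda>a2 a3. scale (\<epsilon> b') (S (a1 * b1) * (a2 * S a3))) a'
        = scale (\<epsilon> a') (scale (\<epsilon> b') (S (a1 * b1)))"
      by (simp add: sweedler_antipode_right scale_mult_right mult.commute)
    ultimately show ?thesis by simp
  qed
  have left: "sweedler (\<lambda>a1 a2. sweedler (\<lambda>b1 b2. ?Y a1 a2 a3 b1 b2 b3) b') a'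
      = scale (\<epsilon> a') (scale (\<epsilon> b') (S b3 * S a3))" for a3 a' b3 b'
  proof -
    have b: "bilinear_map scale scale (\<lambda>x y. S x * (y * (S b3 * S a3)))"
      by (intro bilinear_mapI lin)
    have "sweedler (\<lambda>a1 a2. sweedler (\<lambda>b1 b2. ?Y a1 a2 a3 b1 b2 b3) b') a'
        = sweedler (\<lambda>x y. S x * (y * (S b3 * S a3))) (a' * b')"
      by (simp add: sweedler_mult[OF V b] mult.assoc)
    also have "\<dots> = sweedler (\<lambda>x y. S x * y) (a' * b') * (S b3 * S a3)"
    proof -
      have "klinear scale scale (\<lambda>z. z * (S b3 * S a3))" by (intro lin)
      from klinear_sweedler_apply[OF this] show ?thesis by (simp add: mult.assoc)
    qed
    finally show ?thesis by (simp add: sweedler_antipode_left counit_mult scale_mult_left)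
  qed
  have "S (a * b) = sweedler (\<lambda>a1 a'. sweedler (\<lambda>b1 b'. scale (\<epsilon> a') (scale (\<epsilon> b') (S (a1 * b1)))) b) a"
  proof -
    have "sweedler (\<lambda>b1 b'. scale (\<epsilon> a') (scale (\<epsilon> b') (S (a1 * b1)))) b = scale (\<epsilon> a') (S (a1 * b))" for a1 a'
    proof -
      have "klinear scale scale (\<lambda>b1. scale (\<epsilon> a') (S (a1 * b1)))"
        by (intro klinear_scale_const lin)
      from sweedler_counit_right[OF this, of b] show ?thesis by (simp add: mult.commute)
    qed
    moreover have "klinear scale scale (\<lambda>a1. S (a1 * b))" by (intro lin)
    note sweedler_counit_right[OF this, of a]
    ultimately show ?thesis by simp
  qed
  also have "\<dots> = sweedler (\<lambda>a1 a'. sweedler (\<lambda>a2 a3.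
      sweedler (\<lambda>b1 b'. sweedler (\<lambda>b2 b3. ?Y a1 a2 a3 b1 b2 b3) b') b) a') a"
    unfolding right[symmetric] by (subst (2) sweedler_exchange) (rule refl)
  also have "\<dots> = sweedler (\<lambda>a' a3. sweedler (\<lambda>a1 a2.
      sweedler (\<lambda>b1 b'. sweedler (\<lambda>b2 b3. ?Y a1 a2 a3 b1 b2 b3) b') b) a') a"
    by (rule sweedler_coassoc[OF V, symmetric]) (intro lin)+
  also have "\<dots> = sweedler (\<lambda>a' a3. sweedler (\<lambda>a1 a2.
      sweedler (\<lambda>b' b3. sweedler (\<lambda>b1 b2. ?Y a1 a2 a3 b1 b2 b3) b') b) a') a"
  proof -
    have "sweedler (\<lambda>b1 b'. sweedler (\<lambda>b2 b3. ?Y a1 a2 a3 b1 b2 b3) b') b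
        = sweedler (\<lambda>b' b3. sweedler (\<lambda>b1 b2. ?Y a1 a2 a3 b1 b2 b3) b') b" for a1 a2 a3
      by (rule sweedler_coassoc[OF V, symmetric]) (intro lin)+
    then show ?thesis by simp
  qed
  also have "\<dots> = sweedler (\<lambda>a' a3. sweedler (\<lambda>b' b3. scale (\<epsilon> a') (scale (\<epsilon> b') (S b3 * S a3))) b) a"
    unfolding left[symmetric] by (subst (2) sweedler_exchange) (rule refl)
  also have "\<dots> = S b * S a"
  proof -
    have "sweedler (\<lambda>b' b3. scale (\<epsilon> a') (scale (\<epsilon> b') (S b3 * S a3))) b = scale (\<epsilon> a') (S b * S a3)" for a' a3
    proof -
      have "klinear scale scale (\<lambda>b3. scale (\<epsilon> a') (S b3 * S a3))"
        by (intro klinear_scale_const lin)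
      from sweedler_counit_left[OF this, of b] show ?thesis by (simp add: mult.commute)
    qed
    moreover have "klinear scale scale (\<lambda>a3. S b * S a3)" by (intro lin)
    note sweedler_counit_left[OF this, of a]
    ultimately show ?thesis by simp
  qed
  finally show ?thesis .
qed

lemma antipode_one: "S 1 = 1"
proof -
  have b: "bilinear_map scale scale (\<lambda>x y. S x * y)"
    by (intro bilinear_mapI antipode_klinear_intros)
  have "lift2 scale scale (\<lambda>x y. S x * y) (\<Delta> 1) = S 1 * 1"
    unfolding comult_one lift2_def
    by (subst tensor_lift_pure[OF vector_space_axioms multilinear_of_bilinear[OF b]]) simp_all
  then show ?thesis by (simp add: antipode_left counit_one)
qed

lemma klinear_inv_antipode:
  assumes "bij S"
  shows "klinear scale scale (inv S)"
proof (rule klinearI[OF vector_space_axioms vector_space_axioms])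
  have S: "S (inv S x) = x" for x using assms by (simp add: bij_is_surj surj_f_inv_f)
  have inv: "inv S y = x" if "y = S x" for x y using assms that by (simp add: bij_is_inj)
  show "inv S (x + y) = inv S x + inv S y" for x y
    by (rule inv) (simp add: klinear_add[OF antipode_linear] S)
  show "inv S (scale c x) = scale c (inv S x)" for c x
    by (rule inv) (simp add: klinear_scale[OF antipode_linear] S)
qed

text \<open>Applying the injective antihomomorphism \<open>S\<close> turns the identity into the antipode axiom
  \<open>h\<^sub>1 S(h\<^sub>2) = \<epsilon>(h) 1\<close>.\<close>

lemma sweedler_inv_antipode:
  assumes "bij S"
  shows "sweedler (\<lambda>x y. y * inv S x) h = scale (\<epsilon> h) 1"
proof -
  have "S (sweedler (\<lambda>x y. y * inv S x) h) = sweedler (\<lambda>x y. x * S y) h"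
    using assms
    by (simp add: klinear_sweedler_apply[OF antipode_linear] antipode_antimult bij_is_surj surj_f_inv_f)
  also have "\<dots> = S (scale (\<epsilon> h) 1)"
    by (simp add: sweedler_antipode_right klinear_scale[OF antipode_linear] antipode_one)
  finally show ?thesis using assms by (simp add: bij_is_inj inj_eq)
qed

end


section \<open>Contramodules\<close>

context left_contramodule
begin

lemma contra_sum_list:
  assumes "\<And>v. v \<in> set vs \<Longrightarrow> klinear sD sM (G v)"
  shows "\<alpha> (\<lambda>x. \<Sum>v\<leftarrow>vs. G v x) = (\<Sum>v\<leftarrow>vs. \<alpha> (G v))"
  using assms
proof (induction vs)
  case Nil
  have "klinear sD sM (\<lambda>_. 0)"
    by (rule klinearI[OF D.vector_space_axioms M.vector_space_axioms]) simp_all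
  from contra_scale[OF this, of 0] show ?case by simp
next
  case (Cons v vs)
  then show ?case
    using klinear_sum_list_param[OF D.vector_space_axioms M.vector_space_axioms, of vs "\<lambda>x v. G v x"]
    by (simp add: contra_add)
qed

lemma contra_sweedlers:
  assumes "\<And>vs. length vs = Suc n \<Longrightarrow> klinear sD sM (G vs)"
  shows "\<alpha> (\<lambda>x. D.sweedlers n (\<lambda>vs. G vs x) h) = D.sweedlers n (\<lambda>vs. \<alpha> (G vs)) h"
  unfolding D.sweedlers_def
  by (rule contra_sum_list) (use assms D.length_iter_comult_terms in blast)

lemma klinear_contra:
  assumes "vector_space sV" "\<And>z. klinear sD sM (\<lambda>x. G z x)" "\<And>x. klinear sV sM (\<lambda>z. G z x)"
  shows "klinear sV sM (\<lambda>z. \<alpha> (G z))"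
proof (rule klinearI[OF assms(1) M.vector_space_axioms])
  show "\<alpha> (G (x + y)) = \<alpha> (G x) + \<alpha> (G y)" for x y
  proof -
    have "G (x + y) = (\<lambda>w. G x w + G y w)" using klinear_add[OF assms(3)] by (rule ext)
    then show ?thesis using contra_add[OF assms(2,2)] by simp
  qed
  show "\<alpha> (G (sV c x)) = sM c (\<alpha> (G x))" for c x
  proof -
    have "G (sV c x) = (\<lambda>w. sM c (G x w))" using klinear_scale[OF assms(3)] by (rule ext)
    then show ?thesis using contra_scale[OF assms(2)] by simp
  qed
qed

lemma contra_assoc_sweedler:
  assumes "bilinear_map sD sM G"
  shows "\<alpha> (\<lambda>x. \<alpha> (\<lambda>y. G y x)) = \<alpha> (\<lambda>h. D.sweedler G h)"
proof -
  note W = M.vector_space_axioms and m = D.multilinear_of_bilinear[OF assms]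
  have "lift2 sD sM G \<in> tensor_hom sD 2 sM"
    unfolding lift2_def by (rule tensor_lift_hom[OF W m])
  from contra_assoc[OF this]
  have "\<alpha> (\<lambda>x. \<alpha> (\<lambda>y. lift2 sD sM G (pure_tensor sD [y, x]))) = \<alpha> (\<lambda>h. D.sweedler G h)"
    by (simp only: D.lift2_comult[OF W assms])
  moreover have "lift2 sD sM G (pure_tensor sD [y, x]) = G y x" for x y
    unfolding lift2_def by (subst tensor_lift_pure[OF W m]) simp_all
  ultimately show ?thesis by simp
qed

end

section \<open>Cochains\<close>

definition merge_entries :: "nat \<Rightarrow> 'a::times list \<Rightarrow> 'a list" where
  "merge_entries i as = take i as @ [as ! i * as ! Suc i] @ drop (Suc (Suc i)) as"

definition insert_one :: "nat \<Rightarrow> 'a::one list \<Rightarrow> 'a list" where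
  "insert_one j as = take (Suc j) as @ [1] @ drop (Suc j) as"

locale module_algebra_ayd_coefficients =
  hopf_algebra sH \<Delta> \<epsilon> S + A: left_module_algebra sH \<Delta> \<epsilon> sA actA +
  M: stable_ayd_contramodule sH \<Delta> \<epsilon> S sM actM \<alpha>
  for sH :: "'k::field \<Rightarrow> 'h::{ring,monoid_mult} \<Rightarrow> 'h"
    and \<Delta> :: "'h \<Rightarrow> ('k, 'h) tensor" and \<epsilon> :: "'h \<Rightarrow> 'k" and S :: "'h \<Rightarrow> 'h"
    and sA :: "'k \<Rightarrow> 'a::{ring,monoid_mult} \<Rightarrow> 'a" and actA :: "'h \<Rightarrow> 'a \<Rightarrow> 'a"
    and sM :: "'k \<Rightarrow> 'm::ab_group_add \<Rightarrow> 'm" and actM :: "'h \<Rightarrow> 'm \<Rightarrow> 'm"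
    and \<alpha> :: "('h \<Rightarrow> 'm) \<Rightarrow> 'm" +
  assumes bij_antipode: "bij S"
begin

abbreviation "C \<equiv> cochains sH \<Delta> sA actA sM actM"
abbreviation "d \<equiv> coface sA actA sM \<alpha>"
abbreviation "s \<equiv> codegeneracy sA sM"
abbreviation "t \<equiv> cyclic_operator sA actA sM \<alpha>"
abbreviation "pure \<equiv> pure_tensor sA"

lemmas spaces = vector_space_axioms A.A.vector_space_axioms M.M.vector_space_axioms

lemma klinear_actA: "klinear sH sA (\<lambda>h. actA h a)" "klinear sA sA (actA h)"
  by (simp_all add: Vector_Spaces.linear_iff spaces A.act_add_left A.act_scale_left
      A.act_add_right A.act_scale_right)

lemma klinear_actM: "klinear sH sM (\<lambda>h. actM h m)" "klinear sM sM (actM h)"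
  by (simp_all add: Vector_Spaces.linear_iff spaces M.act_add_left M.act_scale_left
      M.act_add_right M.act_scale_right)

lemma klinear_actA_arg: "klinear sV sH f \<Longrightarrow> klinear sV sA (\<lambda>x. actA (f x) a)"
  by (rule klinear_comp[OF klinear_actA(1)])

lemma sweedler_act_product: "sweedler (\<lambda>x y. actA x a * actA y b) h = actA h (a * b)"
  by (subst A.act_product, rule lift2_comult[symmetric])
    (intro bilinear_mapI spaces A.A.klinear_mult_left A.A.klinear_mult_right klinear_actA)+

text \<open>Acting entrywise on a list is multilinear both in the list of acting elements, as is needed
  to expand iterated coproducts, and in the list acted on, as is needed for the diagonal action
  to descend to the tensor power.\<close>

lemma multilinear_acting:
  assumes W: "vector_space sW" and g: "multilinear sA sW n g" and as: "length as = n"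
  shows "multilinear sH sW n (\<lambda>hs. g (map2 actA hs as))"
proof (rule multilinear_reindex[OF spaces(1,2) W g])
  show "map2 actA (hs[p := z]) as = (map2 actA hs as)[p := actA z (as ! p)]"
    if "length hs = n" "p < n" for hs p z
    using that as by (intro nth_equalityI) (auto simp: nth_list_update)
qed (use as klinear_actA in auto)

lemma multilinear_acted:
  assumes W: "vector_space sW" and g: "multilinear sA sW n g" and hs: "length hs = n"
  shows "multilinear sA sW n (\<lambda>as. g (map2 actA hs as))"
proof (rule multilinear_reindex[OF spaces(2,2) W g])
  show "map2 actA hs (as[p := z]) = (map2 actA hs as)[p := actA (hs ! p) z]"
    if "length as = n" "p < n" for as p z
    using that hs by (intro nth_equalityI) (auto simp: nth_list_update)
qed (use hs klinear_actA in auto)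

lemma diagonal_action_hom_pure:
  shows "diagonal_action sH \<Delta> sA actA n h \<in> tensor_hom sA (Suc n) tscale"
    and "length as = Suc n \<Longrightarrow> diagonal_action sH \<Delta> sA actA n h (pure as)
      = (\<Sum>hs\<leftarrow>iter_comult_terms n h. pure (map2 actA hs as))"
proof -
  have T: "vector_space (tscale :: 'k \<Rightarrow> ('k, 'a) tensor \<Rightarrow> _)" by (rule vector_space_tscale)
  let ?G = "\<lambda>as. sweedlers n (\<lambda>hs. pure (map2 actA hs as)) h"
  have "diagonal_action sH \<Delta> sA actA n h = tensor_lift sA tscale (Suc n) ?G"
    unfolding diagonal_action_def
    by (intro tensor_lift_cong tensor_lift_iter_comult T multilinear_acting multilinear_pure)
  moreover have "multilinear sA tscale (Suc n) ?G"
    by (intro multilinearI spaces T klinear_sweedlers_param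
        multilinear_update[OF spaces(2) T multilinear_acted[OF T multilinear_pure]])
  ultimately show "diagonal_action sH \<Delta> sA actA n h \<in> tensor_hom sA (Suc n) tscale"
    "length as = Suc n \<Longrightarrow> diagonal_action sH \<Delta> sA actA n h (pure as)
      = (\<Sum>hs\<leftarrow>iter_comult_terms n h. pure (map2 actA hs as))"
    using tensor_lift_hom[OF T] tensor_lift_pure[OF T] by (auto simp: sweedlers_def)
qed

lemma tensor_hom_diagonal_action:
  assumes f: "f \<in> tensor_hom sA (Suc n) sM" and as: "length as = Suc n"
  shows "f (diagonal_action sH \<Delta> sA actA n h (pure as)) = sweedlers n (\<lambda>hs. f (pure (map2 actA hs as))) h"
  using tensor_hom_sum_pure[OF f, of "map (\<lambda>hs. map2 actA hs as) (iter_comult_terms n h)"]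
  by (simp add: diagonal_action_hom_pure(2)[OF as] sweedlers_def o_def length_iter_comult_terms as)

lemma cochain_hom: "f \<in> C n \<Longrightarrow> f \<in> tensor_hom sA (Suc n) sM"
  by (simp add: cochains_def)

lemmas cochain_eqI = tensor_hom_eqI[OF spaces(3) cochain_hom cochain_hom]

lemma cochain_act:
  assumes "f \<in> C n" "length as = Suc n"
  shows "sweedlers n (\<lambda>hs. f (pure (map2 actA hs as))) h = actM h (f (pure as))"
  using tensor_hom_diagonal_action[OF cochain_hom[OF assms(1)] assms(2), of h] assms
  by (simp add: cochains_def pure_in_tensor_power)

text \<open>Membership in the complex is checked on pure tensors, where the diagonal action is a Sweedler
  expression. All later computations go through this criterion and its converse
  \<open>cochain_act\<close>.\<close>

lemma cochainI:
  assumes f: "f \<in> tensor_hom sA (Suc n) sM"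
    and act: "\<And>h as. length as = Suc n \<Longrightarrow>
      sweedlers n (\<lambda>hs. f (pure (map2 actA hs as))) h = actM h (f (pure as))"
  shows "f \<in> C n"
proof -
  have "f (diagonal_action sH \<Delta> sA actA n h x) = actM h (f x)" if x: "x \<in> tensor_power sA (Suc n)" for h x
  proof -
    let ?D = "diagonal_action sH \<Delta> sA actA n h"
    obtain vss where len: "\<forall>vs\<in>set vss. length vs = Suc n" and x: "x = (\<Sum>vs\<leftarrow>vss. pure vs)"
      using tensor_power_sum_pure[OF x] by blast
    let ?wss = "concat (map (\<lambda>vs. map (\<lambda>hs. map2 actA hs vs) (iter_comult_terms n h)) vss)"
    have "?D x = (\<Sum>vs\<leftarrow>vss. ?D (pure vs))"
      unfolding x by (rule tensor_hom_sum_pure[OF diagonal_action_hom_pure(1) len])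
    also have "\<dots> = (\<Sum>vs\<leftarrow>vss. \<Sum>hs\<leftarrow>iter_comult_terms n h. pure (map2 actA hs vs))"
      using len by (intro arg_cong[where f = sum_list] map_cong diagonal_action_hom_pure(2)) auto
    also have "\<dots> = (\<Sum>ws\<leftarrow>?wss. pure ws)"
      by (simp only: sum_list_map_concat map_map o_def)
    finally have "f (?D x) = (\<Sum>ws\<leftarrow>?wss. f (pure ws))"
      using tensor_hom_sum_pure[OF f, of ?wss] len by (auto simp: length_iter_comult_terms)
    also have "\<dots> = (\<Sum>vs\<leftarrow>vss. sweedlers n (\<lambda>hs. f (pure (map2 actA hs vs))) h)"
      by (simp only: sum_list_map_concat map_map o_def sweedlers_def)
    also have "\<dots> = (\<Sum>vs\<leftarrow>vss. actM h (f (pure vs)))"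
      using len by (intro arg_cong[where f = sum_list] map_cong act) auto
    also have "\<dots> = actM h (f x)"
      unfolding x tensor_hom_sum_pure[OF f len] by (rule klinear_sum_list[OF klinear_actM(2), symmetric])
    finally show ?thesis .
  qed
  with f show ?thesis by (simp add: cochains_def)
qed

lemma cochains_subspace: "module.subspace (scale_fun sM) (C n)"
proof -
  interpret F: vector_space "scale_fun sM :: _ \<Rightarrow> (('k, 'a) tensor \<Rightarrow> _) \<Rightarrow> _"
    by (rule vector_space_scale_fun[OF spaces(3)])
  note hom = tensor_hom_subspace[OF spaces(3), of sA "Suc n"]
  show ?thesis
  proof (rule F.subspaceI)
    show "0 \<in> C n"
      using F.subspace_0[OF hom] klinear_zero[OF klinear_actM(2)] by (simp add: cochains_def)
    show "f + g \<in> C n" if "f \<in> C n" "g \<in> C n" for f g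
      using that F.subspace_add[OF hom] by (simp add: cochains_def M.act_add_right)
    show "scale_fun sM c f \<in> C n" if "f \<in> C n" for c f
      using that F.subspace_scale[OF hom] by (simp add: cochains_def scale_fun_def M.act_scale_right)
  qed
qed

section \<open>The operators preserve cochains\<close>

lemma multilinear_merge_entries:
  assumes g: "multilinear sA sW (Suc n) g" and W: "vector_space sW" and i: "i \<le> n"
  shows "multilinear sA sW (Suc (Suc n)) (\<lambda>as. g (merge_entries i as))"
proof (rule multilinear_reindex[OF spaces(2,2) W g])
  let ?u = "\<lambda>p as z. if p = i then z * as ! Suc i else if p = Suc i then as ! i * z else z"
  show "merge_entries i (as[p := z]) = (merge_entries i as)[if p \<le> i then p else p - 1 := ?u p as z]"
    if "length as = Suc (Suc n)" "p < Suc (Suc n)" for as p and z :: 'a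
    using that i
    by (intro nth_equalityI)
      (auto simp: merge_entries_def nth_append nth_list_update nth_Cons split: nat.splits)
  show "klinear sA sA (?u p as)" for p as
    using A.A.klinear_mult_left A.A.klinear_mult_right klinear_ident[OF spaces(2)] by (cases "p = i"; cases "p = Suc i") simp_all
qed (use i in \<open>auto simp: merge_entries_def\<close>)

lemma multilinear_insert_one:
  assumes g: "multilinear sA sW (Suc (Suc n)) g" and W: "vector_space sW" and j: "j \<le> n"
  shows "multilinear sA sW (Suc n) (\<lambda>as. g (insert_one j as))"
proof (rule multilinear_reindex[OF spaces(2,2) W g])
  show "insert_one j (as[p := z]) = (insert_one j as)[if p \<le> j then p else Suc p := z]"
    if "length as = Suc n" "p < Suc n" for as p and z :: 'a
    using that j
    by (intro nth_equalityI)
      (auto simp: insert_one_def nth_append nth_list_update nth_Cons split: nat.splits)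
  show "klinear sA sA (\<lambda>z. z)" by (rule klinear_ident[OF spaces(2)])
qed (use j in \<open>auto simp: insert_one_def\<close>)

text \<open>The rotated entry may be the one that varies: then linearity comes from the action, otherwise
  from \<open>g\<close>. In both cases \<open>\<alpha>\<close> is applied to a family of linear maps that varies linearly.\<close>

lemma multilinear_rotate:
  assumes g: "multilinear sA sM (Suc n) g"
  shows "multilinear sA sM (Suc n) (\<lambda>as. \<alpha> (\<lambda>h. g (actA h (last as) # butlast as)))"
proof (rule multilinearI[OF spaces(2,3)])
  fix as :: "'a list" and p
  assume as: "length as = Suc n" and p: "p < Suc n"
  have h: "klinear sH sM (\<lambda>h. g (actA h a # bs))" if "length bs = n" for a bs
    using that by (intro klinear_comp[OF multilinear_Cons[OF spaces(2,3) g] klinear_actA(1)]) simp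
  show "klinear sA sM (\<lambda>x. \<alpha> (\<lambda>h. g (actA h (last (as[p := x])) # butlast (as[p := x]))))"
  proof (rule M.klinear_contra[OF spaces(2)])
    show "klinear sH sM (\<lambda>h. g (actA h (last (as[p := x])) # butlast (as[p := x])))" for x
      using as by (intro h) simp
    show "klinear sA sM (\<lambda>x. g (actA h (last (as[p := x])) # butlast (as[p := x])))" for h
    proof (cases "p = n")
      case True
      have "actA h (last (as[p := x])) # butlast (as[p := x]) = actA h x # butlast as" for x
        using True as by (cases "as = []") (auto simp: last_list_update butlast_list_update)
      moreover have "klinear sA sM (\<lambda>x. g (actA h x # butlast as))"
        using as by (intro klinear_comp[OF multilinear_Cons[OF spaces(2,3) g] klinear_actA(2)]) simp
      ultimately show ?thesis by simp
    next
      case False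
      have "actA h (last (as[p := x])) # butlast (as[p := x])
          = (actA h (last as) # butlast as)[Suc p := x]" for x
        using False as p by (cases "as = []") (auto simp: last_list_update butlast_list_update)
      moreover have "klinear sA sM (\<lambda>x. g ((actA h (last as) # butlast as)[Suc p := x]))"
        using as p False by (intro multilinear_update[OF spaces(2,3) g]) auto
      ultimately show ?thesis by simp
    qed
  qed
qed

lemmas cochain_klinear_Cons = multilinear_Cons[OF spaces(2,3) cochain_multilinear]
lemmas cochain_klinear_update = multilinear_update[OF spaces(2,3) cochain_multilinear]

lemma d_pure:
  assumes "f \<in> C n" "i \<le> n" "length as = Suc (Suc n)"
  shows "d n i f (pure as) = f (pure (merge_entries i as))"
  unfolding merge_entries_def
  by (rule coface_pure[OF spaces(3) A.A.k_algebra_axioms assms])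

lemma s_pure:
  assumes "f \<in> C (Suc n)" "j \<le> n" "length as = Suc n"
  shows "s n j f (pure as) = f (pure (insert_one j as))"
  unfolding insert_one_def by (rule codegeneracy_pure[OF spaces(3) assms])

lemma t_pure:
  assumes "f \<in> C n" "length as = Suc n"
  shows "t n f (pure as) = \<alpha> (\<lambda>h. f (pure (actA h (last as) # butlast as)))"
  by (rule cyclic_operator_pure[OF M.left_contramodule_axioms A.left_module_axioms assms])

text \<open>Merging entries \<open>i\<close> and \<open>i + 1\<close> pairs their two coproduct factors. Producing these two last,
  by splitting factor \<open>i\<close>, lets the module algebra law
  \<open>(h\<^sub>1 \<cdot> a)(h\<^sub>2 \<cdot> b) = h \<cdot> (a b)\<close> absorb them.\<close>

lemma d_in:
  assumes f: "f \<in> C n" and i: "i \<le> n"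
  shows "d n i f \<in> C (Suc n)"
proof (rule cochainI)
  note m = multilinear_merge_entries[OF cochain_multilinear[OF f] spaces(3) i]
  show "d n i f \<in> tensor_hom sA (Suc (Suc n)) sM"
    using tensor_lift_hom[OF spaces(3) m] i by (simp add: coface_def merge_entries_def)
  fix h and as :: "'a list"
  assume as: "length as = Suc (Suc n)"
  let ?G = "\<lambda>hs. f (pure (merge_entries i (map2 actA hs as)))"
  have "sweedlers (Suc n) (\<lambda>hs. d n i f (pure (map2 actA hs as))) h = sweedlers (Suc n) ?G h"
    using as by (intro sweedlers_cong d_pure[OF f i]) simp
  also have "\<dots> = sweedlers n (split_entry i ?G) h"
    by (rule sweedlers_split_entry[OF spaces(3) multilinear_acting[OF spaces(3) m as] i])
  also have "\<dots> = sweedlers n (\<lambda>hs. f (pure (map2 actA hs (merge_entries i as)))) h"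
  proof (rule sweedlers_cong)
    fix hs :: "'h list"
    assume hs: "length hs = Suc n"
    let ?L = "map2 actA hs (merge_entries i as)"
    have lenL: "length ?L = Suc n" using hs as i by (simp add: merge_entries_def)
    have lin: "klinear sA sM (\<lambda>a. f (pure (?L[i := a])))"
      using lenL i by (intro cochain_klinear_update[OF f]) auto
    have "merge_entries i (map2 actA (take i hs @ x # y # drop (Suc i) hs) as)
        = ?L[i := actA x (as ! i) * actA y (as ! Suc i)]" for x y
      using hs as i
      by (intro nth_equalityI)
        (auto simp: merge_entries_def nth_append nth_list_update nth_Cons' min_def)
    then have "split_entry i ?G hs
        = sweedler (\<lambda>x y. f (pure (?L[i := actA x (as ! i) * actA y (as ! Suc i)]))) (hs ! i)"
      by (simp add: split_entry_def)
    also have "\<dots> = f (pure (?L[i := sweedler (\<lambda>x y. actA x (as ! i) * actA y (as ! Suc i)) (hs ! i)]))"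
      by (rule klinear_sweedler_apply[OF lin, symmetric])
    also have "sweedler (\<lambda>x y. actA x (as ! i) * actA y (as ! Suc i)) (hs ! i) = ?L ! i"
      using hs as i by (simp add: sweedler_act_product merge_entries_def nth_append)
    finally show "split_entry i ?G hs = f (pure ?L)" by simp
  qed
  also have "\<dots> = actM h (f (pure (merge_entries i as)))"
    using as i by (intro cochain_act[OF f]) (simp add: merge_entries_def)
  finally show "sweedlers (Suc n) (\<lambda>hs. d n i f (pure (map2 actA hs as))) h = actM h (d n i f (pure as))"
    by (simp add: d_pure[OF f i as])
qed

text \<open>The coproduct factor that meets the inserted unit acts through \<open>\<epsilon>\<close>; splitting it off its
  left neighbour makes the counit law remove it.\<close>

lemma s_in:
  assumes f: "f \<in> C (Suc n)" and j: "j \<le> n"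
  shows "s n j f \<in> C n"
proof (rule cochainI)
  note m = multilinear_insert_one[OF cochain_multilinear[OF f] spaces(3) j]
  show "s n j f \<in> tensor_hom sA (Suc n) sM"
    using tensor_lift_hom[OF spaces(3) m] by (simp add: codegeneracy_def insert_one_def)
  fix h and as :: "'a list"
  assume as: "length as = Suc n"
  have ins: "length (insert_one j as) = Suc (Suc n)" using as j by (simp add: insert_one_def)
  let ?G = "\<lambda>hs. f (pure (map2 actA hs (insert_one j as)))"
  have "actM h (s n j f (pure as)) = sweedlers (Suc n) ?G h"
    by (simp add: s_pure[OF f j as] cochain_act[OF f ins])
  also have "\<dots> = sweedlers n (split_entry j ?G) h"
    by (rule sweedlers_split_entry[OF spaces(3) multilinear_acting[OF spaces(3) cochain_multilinear[OF f] ins] j])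
  also have "\<dots> = sweedlers n (\<lambda>hs. s n j f (pure (map2 actA hs as))) h"
  proof (rule sweedlers_cong)
    fix hs :: "'h list"
    assume hs: "length hs = Suc n"
    let ?L = "insert_one j (map2 actA hs as)"
    have lenL: "length ?L = Suc (Suc n)" using hs as j by (simp add: insert_one_def)
    have "map2 actA (take j hs @ x # y # drop (Suc j) hs) (insert_one j as)
        = ?L[j := actA x (as ! j), Suc j := sA (\<epsilon> y) 1]" for x y
      using hs as j
      by (intro nth_equalityI)
        (auto simp: insert_one_def nth_append nth_list_update nth_Cons' min_def A.act_unit)
    moreover have "f (pure (?L[j := a, Suc j := sA c 1])) = sM c (f (pure (?L[j := a])))" for a c
    proof -
      have "?L[j := a, Suc j := 1] = ?L[j := a]"
        using hs as j
        by (intro nth_equalityI) (auto simp: insert_one_def nth_append nth_list_update)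
      then show ?thesis
        using klinear_scale[OF cochain_klinear_update[OF f, of "?L[j := a]" "Suc j"], of c 1] lenL j by simp
    qed
    ultimately have "split_entry j ?G hs
        = sweedler (\<lambda>x y. sM (\<epsilon> y) (f (pure (?L[j := actA x (as ! j)])))) (hs ! j)"
      by (simp add: split_entry_def)
    also have "\<dots> = f (pure (?L[j := actA (hs ! j) (as ! j)]))"
      using lenL j
      by (intro sweedler_counit_right klinear_comp[OF cochain_klinear_update[OF f] klinear_actA(1)]) auto
    also have "?L[j := actA (hs ! j) (as ! j)] = ?L"
      using hs as j by (intro nth_equalityI) (auto simp: insert_one_def nth_append nth_list_update)
    finally show "split_entry j ?G hs = s n j f (pure (map2 actA hs as))"
      using hs as by (simp add: s_pure[OF f j])
  qed
  finally show "sweedlers n (\<lambda>hs. s n j f (pure (map2 actA hs as))) h = actM h (s n j f (pure as))"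
    by simp
qed

text \<open>Here \<open>?K x\<close> is the form that the anti-Yetter-Drinfeld condition produces from
  \<open>h \<cdot> \<tau>(f)(a\<^sup>0, \<dots>, a\<^sup>n)\<close> inside \<open>\<alpha>\<close>, and \<open>?G x\<close> the one that comes from applying \<open>\<tau>(f)\<close> to
  the diagonal action. They differ by the factor \<open>h\<^sub>2 S\<^sup>-\<^sup>1(h\<^sub>1)\<close> in the first entry, which the
  antipode removes.\<close>

lemma t_in:
  assumes f: "f \<in> C n"
  shows "t n f \<in> C n"
proof (rule cochainI)
  show "t n f \<in> tensor_hom sA (Suc n) sM"
    unfolding cyclic_operator_def
    by (rule tensor_lift_hom[OF spaces(3) multilinear_rotate[OF cochain_multilinear[OF f]]])
  fix h and as :: "'a list"
  assume as: "length as = Suc n"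
  let ?F = "\<lambda>x. f (pure (actA x (as ! n) # butlast as))"
  let ?I = "\<lambda>x hs. actA (x * hs ! n) (as ! n) # map2 actA (take n hs) as"
  let ?J = "\<lambda>x us. actA (us ! 1 * inv S (us ! 0) * x * us ! Suc (Suc n)) (as ! n)
    # map2 actA (take n (drop 2 us)) as"
  let ?G = "\<lambda>x hs. f (pure (?I x hs))" and ?K = "\<lambda>x us. f (pure (?J x us))"
  note fm = cochain_multilinear[OF f]
  note inv_lin = klinear_comp[OF klinear_inv_antipode[OF bij_antipode]]
  note lin = klinear_mult_left klinear_mult_right inv_lin klinear_ident spaces
  have last: "last as = as ! n" "butlast as = take n as"
    using as by (cases "as = []"; simp add: last_conv_nth butlast_conv_take)+
  have head: "klinear sH sM (\<lambda>z. f (pure (actA (l z) (as ! n) # bs)))"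
    if "klinear sH sH l" "length bs = n" for l bs
    using that by (intro klinear_comp[OF cochain_klinear_Cons[OF f] klinear_actA_arg]) auto
  have mG: "multilinear sH sM (Suc n) (?G x)" for x
  proof (rule multilinear_reindex[OF spaces(1-3) fm])
    let ?u = "\<lambda>p (hs :: 'h list) z. if p = n then actA (x * z) (as ! n) else actA z (as ! p)"
    show "?I x (hs[p := z]) = (?I x hs)[if p = n then 0 else Suc p := ?u p hs z]"
      if "length hs = Suc n" "p < Suc n" for hs p z
      using that as by (intro nth_equalityI) (auto simp: nth_list_update nth_Cons' split: nat.splits)
    show "klinear sH sA (?u p hs)" for p hs
      by (cases "p = n") (simp_all add: klinear_actA klinear_actA_arg lin)
  qed (use as in auto)
  have mK: "multilinear sH sM (Suc (Suc (Suc n))) (?K x)" for x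
  proof (rule multilinear_reindex[OF spaces(1-3) fm])
    let ?u = "\<lambda>p (us :: 'h list) z.
      if p = 0 then actA (us ! 1 * inv S z * x * us ! Suc (Suc n)) (as ! n)
      else if p = 1 then actA (z * inv S (us ! 0) * x * us ! Suc (Suc n)) (as ! n)
      else if p = Suc (Suc n) then actA (us ! 1 * inv S (us ! 0) * x * z) (as ! n)
      else actA z (as ! (p - 2))"
    show "?J x (us[p := z]) = (?J x us)[if p = 0 \<or> p = 1 \<or> p = Suc (Suc n) then 0 else p - 1 := ?u p us z]"
      if "length us = Suc (Suc (Suc n))" "p < Suc (Suc (Suc n))" for us p z
    proof (cases "p < 2")
      case True
      then have "p = 0 \<or> p = 1" by auto
      then show ?thesis using that as by auto
    next
      case False
      then obtain q where "p = Suc (Suc q)" by (metis add_2_eq_Suc not_less le_Suc_ex)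
      then show ?thesis
        using that as by (intro nth_equalityI) (auto simp: nth_list_update nth_Cons')
    qed
    show "klinear sH sA (?u p us)" for p us
    proof -
      have "klinear sH sA (\<lambda>z. actA (us ! 1 * inv S z * x * us ! Suc (Suc n)) (as ! n))"
        "klinear sH sA (\<lambda>z. actA (z * inv S (us ! 0) * x * us ! Suc (Suc n)) (as ! n))"
        "klinear sH sA (\<lambda>z. actA (us ! 1 * inv S (us ! 0) * x * z) (as ! n))"
        by (intro klinear_actA_arg lin)+
      then show ?thesis using klinear_actA(1) by (cases "p = 0"; cases "p = 1"; cases "p = Suc (Suc n)") simp_all
    qed
  qed (use as in auto)
  \<comment> \<open>The three factors supplied by the anti-Yetter-Drinfeld condition, the middle one
    distributed over the tensor, form an \<open>(n + 3)\<close>-fold comultiplication.\<close>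
  have outer: "sweedlers 2 (\<lambda>vs. actM (vs ! 1) (?F (inv S (vs ! 0) * x * vs ! 2))) h
      = sweedlers (Suc (Suc n)) (?K x) h" for x
  proof -
    have "sweedlers (2 + n) (?K x) h
        = sweedlers 2 (\<lambda>vs. sweedlers n (\<lambda>ks. ?K x (take 1 vs @ ks @ drop (Suc 1) vs)) (vs ! 1)) h"
      by (rule sweedlers_nested[OF spaces(3)]) (use mK in simp_all)
    also have "\<dots> = sweedlers 2 (\<lambda>vs. actM (vs ! 1) (?F (inv S (vs ! 0) * x * vs ! 2))) h"
    proof (rule sweedlers_cong)
      fix vs :: "'h list"
      assume vs: "length vs = Suc 2"
      let ?bs = "actA (inv S (vs ! 0) * x * vs ! 2) (as ! n) # butlast as"
      have "?J x (take 1 vs @ ks @ drop (Suc 1) vs) = map2 actA ks ?bs" if "length ks = Suc n" for ks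
        using that vs as
        by (intro nth_equalityI)
          (auto simp: nth_append nth_Cons' nth_butlast A.act_mult[symmetric] mult.assoc numeral_2_eq_2)
      then have "sweedlers n (\<lambda>ks. ?K x (take 1 vs @ ks @ drop (Suc 1) vs)) (vs ! 1)
          = sweedlers n (\<lambda>ks. f (pure (map2 actA ks ?bs))) (vs ! 1)"
        by (intro sweedlers_cong) simp
      also have "\<dots> = actM (vs ! 1) (?F (inv S (vs ! 0) * x * vs ! 2))"
        using as by (intro cochain_act[OF f]) simp
      finally show "sweedlers n (\<lambda>ks. ?K x (take 1 vs @ ks @ drop (Suc 1) vs)) (vs ! 1) = \<dots>" .
    qed
    finally show ?thesis by simp
  qed
  \<comment> \<open>Now \<open>h\<^sub>2 S\<^sup>-\<^sup>1(h\<^sub>1) = \<epsilon>(h)\<close> removes the two leading factors.\<close>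
  have contract: "sweedlers (Suc (Suc n)) (?K x) h = sweedlers n (?G x) h" for x
  proof -
    have "sweedlers (Suc (Suc n)) (?K x) h = sweedlers (Suc n) (split_entry 0 (?K x)) h"
      by (rule sweedlers_Suc)
    also have "\<dots> = sweedlers (Suc n) (\<lambda>vs. sM (\<epsilon> (vs ! 0)) (?G x (tl vs))) h"
    proof (rule sweedlers_cong)
      fix vs :: "'h list"
      assume vs: "length vs = Suc (Suc n)"
      let ?\<psi> = "\<lambda>z. f (pure (actA (z * x * vs ! Suc n) (as ! n) # map2 actA (take n (tl vs)) as))"
      have \<psi>: "klinear sH sM ?\<psi>" by (rule head, intro lin) (use vs as in simp)
      have "split_entry 0 (?K x) vs = sweedler (\<lambda>u v. ?\<psi> (v * inv S u)) (vs ! 0)"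
        using vs by (simp add: split_entry_def drop_Suc numeral_2_eq_2 nth_tl)
      also have "\<dots> = ?\<psi> (sweedler (\<lambda>u v. v * inv S u) (vs ! 0))"
        by (rule klinear_sweedler_apply[OF \<psi>, symmetric])
      also have "\<dots> = ?\<psi> (sH (\<epsilon> (vs ! 0)) 1)"
        by (simp only: sweedler_inv_antipode[OF bij_antipode])
      also have "\<dots> = sM (\<epsilon> (vs ! 0)) (?\<psi> 1)" by (rule klinear_scale[OF \<psi>])
      finally show "split_entry 0 (?K x) vs = sM (\<epsilon> (vs ! 0)) (?G x (tl vs))"
        using vs by (simp add: nth_tl)
    qed
    also have "\<dots> = sweedlers n (?G x) h"
      unfolding sweedlers_Suc
    proof (rule sweedlers_cong)
      fix ws :: "'h list"
      assume ws: "length ws = Suc n"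
      have lin: "klinear sH sM (\<lambda>v. ?G x (v # tl ws))"
        using ws by (intro multilinear_Cons[OF spaces(1,3) mG]) simp
      have "split_entry 0 (\<lambda>vs. sM (\<epsilon> (vs ! 0)) (?G x (tl vs))) ws
          = sweedler (\<lambda>u v. sM (\<epsilon> u) (?G x (v # tl ws))) (ws ! 0)"
        by (simp add: split_entry_def drop_Suc)
      also have "\<dots> = ?G x (ws ! 0 # tl ws)" by (rule sweedler_counit_left[OF lin])
      also have "ws ! 0 # tl ws = ws" using ws by (cases ws) auto
      finally show "split_entry 0 (\<lambda>vs. sM (\<epsilon> (vs ! 0)) (?G x (tl vs))) ws = ?G x ws" .
    qed
    finally show ?thesis .
  qed
  have "sweedlers n (\<lambda>hs. t n f (pure (map2 actA hs as))) h = sweedlers n (\<lambda>hs. \<alpha> (\<lambda>x. ?G x hs)) h"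
  proof (rule sweedlers_cong)
    fix hs :: "'h list"
    assume hs: "length hs = Suc n"
    have "map2 actA hs as \<noteq> []" using hs as by auto
    then have "last (map2 actA hs as) = actA (hs ! n) (as ! n)"
      using hs as by (simp add: last_conv_nth)
    then have "actA x (last (map2 actA hs as)) # butlast (map2 actA hs as) = ?I x hs" for x
      using hs as by (intro nth_equalityI) (auto simp: nth_Cons' nth_butlast A.act_mult)
    then show "t n f (pure (map2 actA hs as)) = \<alpha> (\<lambda>x. ?G x hs)"
      using hs as by (simp add: t_pure[OF f])
  qed
  also have "\<dots> = \<alpha> (\<lambda>x. sweedlers n (?G x) h)"
  proof (rule M.contra_sweedlers[symmetric])
    show "klinear sH sM (\<lambda>x. ?G x hs)" if "length hs = Suc n" for hs
      by (rule head, intro lin) (use that as in simp)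
  qed
  also have "\<dots> = \<alpha> (\<lambda>x. lift3 sH sM (\<lambda>h1 h2 h3. actM h2 (?F (inv S h1 * x * h3))) (iter_comult sH \<Delta> 2 h))"
  proof -
    have "lift3 sH sM (\<lambda>h1 h2 h3. actM h2 (?F (inv S h1 * x * h3))) (iter_comult sH \<Delta> 2 h)
        = sweedlers n (?G x) h" for x
    proof -
      have F: "klinear sH sM (\<lambda>z. actM v (?F (l z)))" if "klinear sH sH l" for v l
        using as that by (intro klinear_comp[OF klinear_actM(2)] head) auto
      have "klinear sH sM (\<lambda>z. actM v (?F (inv S z * x * w)))"
        "klinear sH sM (\<lambda>z. actM v (?F (inv S w * x * z)))" for v w
        by (intro F lin)+
      then have "multilinear sH sM 3 (\<lambda>vs. actM (vs ! 1) (?F (inv S (vs ! 0) * x * vs ! 2)))"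
        using klinear_actM(1)
        by (auto simp: multilinear_def Vector_Spaces.linear_iff less_Suc_eq numeral_3_eq_3 numeral_2_eq_2)
      then have "lift3 sH sM (\<lambda>h1 h2 h3. actM h2 (?F (inv S h1 * x * h3))) (iter_comult sH \<Delta> 2 h)
          = sweedlers 2 (\<lambda>vs. actM (vs ! 1) (?F (inv S (vs ! 0) * x * vs ! 2))) h"
        using tensor_lift_iter_comult[OF spaces(3), of 2] by (simp add: lift3_def)
      then show ?thesis by (simp only: outer contract)
    qed
    then show ?thesis by simp
  qed
  also have "\<dots> = actM h (\<alpha> ?F)"
    by (rule M.ayd_compat[symmetric], rule head, intro lin) (use as in simp)
  also have "\<dots> = actM h (t n f (pure as))"
    by (simp add: t_pure[OF f as] last)
  finally show "sweedlers n (\<lambda>hs. t n f (pure (map2 actA hs as))) h = actM h (t n f (pure as))" .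
qed

text \<open>The product \<open>((-) \<cdot> a\<^sup>n\<^sup>+\<^sup>1) a\<^sup>0\<close> merges the first two entries of the rotated list. Thereby
  most statements about the last coface reduce to the relations between \<open>\<tau>\<close> and the other
  operators.\<close>

lemma last_d_eq:
  assumes f: "f \<in> C n"
  shows "d n (Suc n) f = t (Suc n) (d n 0 f)"
  unfolding coface_def[of _ _ _ _ n "Suc n"] cyclic_operator_def
proof (rule tensor_lift_cong)
  fix as :: "'a list"
  assume as: "length as = Suc (Suc n)"
  have "merge_entries 0 (actA h (last as) # butlast as) = (actA h (last as) * hd as) # butlast (tl as)" for h
    using as by (auto simp: merge_entries_def length_Suc_conv)
  then show "(if Suc n \<le> n then f (pure (take (Suc n) as @ [as ! Suc n * as ! Suc (Suc n)] @ drop (Suc (Suc (Suc n))) as))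
      else \<alpha> (\<lambda>h. f (pure ((actA h (last as) * hd as) # butlast (tl as)))))
    = \<alpha> (\<lambda>h. d n 0 f (pure (actA h (last as) # butlast as)))"
    using as by (simp add: d_pure[OF f])
qed

lemma t_power_in: "f \<in> C n \<Longrightarrow> (t n ^^ i) f \<in> C n"
  by (induction i) (auto intro: t_in)

text \<open>Iterating \<open>\<tau>\<close> nests applications of \<open>\<alpha>\<close>. Each new rotation adds an outer application whose
  argument acts on the entry that follows the ones already rotated; contra-associativity merges
  it with the inner one, and the two arguments become the coproduct of a single one.\<close>

lemma t_power_pure:
  assumes f: "f \<in> C n" and m: "m \<le> n" and as: "length as = Suc n"
  shows "(t n ^^ Suc m) f (pure as) =
    \<alpha> (sweedlers m (\<lambda>hs. f (pure (map2 actA hs (drop (n - m) as) @ take (n - m) as))))"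
  using m as
proof (induction m arbitrary: as)
  case 0
  then have "drop n as = [last as]" "take n as = butlast as"
    by (cases as rule: rev_cases; simp)+
  then show ?case using 0 by (simp add: t_pure[OF f] sweedlers_0)
next
  case (Suc m)
  let ?k = "n - Suc m"
  let ?g = "\<lambda>hs. f (pure (map2 actA hs (drop ?k as) @ take ?k as))"
  note as = Suc.prems(2) and m = Suc.prems(1)
  have k: "n - m = Suc ?k" using m by simp
  have mg: "multilinear sH sM (Suc (Suc m)) ?g"
  proof (rule multilinear_acting[where g = "\<lambda>bs. f (pure (bs @ take ?k as))"])
    show "multilinear sA sM (Suc (Suc m)) (\<lambda>bs. f (pure (bs @ take ?k as)))"
    proof (rule multilinear_reindex[OF spaces(2,2,3) cochain_multilinear[OF f]])
      show "bs[p := z] @ take ?k as = (bs @ take ?k as)[p := z]"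
        if "length bs = Suc (Suc m)" "p < Suc (Suc m)" for bs p z
        using that by (simp add: list_update_append)
    qed (use m as klinear_ident[OF spaces(2)] in auto)
  qed (use m as spaces in auto)
  have "(t n ^^ Suc (Suc m)) f (pure as) = t n ((t n ^^ Suc m) f) (pure as)" by simp
  also have "\<dots> = \<alpha> (\<lambda>x. (t n ^^ Suc m) f (pure (actA x (last as) # butlast as)))"
    by (rule t_pure[OF t_power_in[OF f] as])
  also have "\<dots> = \<alpha> (\<lambda>x. \<alpha> (\<lambda>y. sweedlers m (\<lambda>hs. ?g (hs @ [x])) y))"
  proof -
    have "(t n ^^ Suc m) f (pure (actA x (last as) # butlast as))
        = \<alpha> (sweedlers m (\<lambda>hs. ?g (hs @ [x])))" for x
    proof -
      have dr: "drop ?k as = drop ?k (butlast as) @ [last as]"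
        using as m by (cases as rule: rev_cases) auto
      have "map2 actA hs (drop ?k (butlast as)) @ actA x (last as) # take ?k (butlast as)
          = map2 actA (hs @ [x]) (drop ?k as) @ take ?k as" if "length hs = Suc m" for hs
      proof -
        have "take ?k (butlast as) = take ?k as" using as m by (simp add: butlast_conv_take)
        moreover have "length (drop ?k (butlast as)) = Suc m" using as m by simp
        ultimately show ?thesis using that by (simp add: dr)
      qed
      then have "sweedlers m (\<lambda>hs. f (pure (map2 actA hs (drop ?k (butlast as)) @ actA x (last as) # take ?k (butlast as))))
          = sweedlers m (\<lambda>hs. ?g (hs @ [x]))"
        by (intro ext sweedlers_cong) simp
      then show ?thesis
        using Suc.IH[of "actA x (last as) # butlast as"] as m by (simp add: k)
    qed
    then show ?thesis by simp
  qed
  also have "\<dots> = \<alpha> (sweedler (\<lambda>y x. sweedlers m (\<lambda>hs. ?g (hs @ [x])) y))"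
  proof (rule M.contra_assoc_sweedler, rule bilinear_mapI)
    show "klinear sH sM (sweedlers m (\<lambda>hs. ?g (hs @ [x])))" for x
    proof (rule klinear_sweedlers[OF spaces(3) multilinear_reindex[OF spaces(1,1,3) mg]])
      show "hs[p := z] @ [x] = (hs @ [x])[p := z]" if "length hs = Suc m" "p < Suc m" for hs p z
        using that by (simp add: list_update_append)
    qed (use klinear_ident[OF spaces(1)] in auto)
    show "klinear sH sM (\<lambda>x. sweedlers m (\<lambda>hs. ?g (hs @ [x])) y)" for y
      by (intro klinear_sweedlers_param spaces multilinear_middle[OF spaces(1,3) mg]) simp
  qed
  also have "\<dots> = \<alpha> (sweedlers (Suc m) ?g)"
  proof -
    have "sweedlers (1 + m) ?g h = sweedlers 1 (\<lambda>vs. sweedlers m (\<lambda>ks. ?g (take 0 vs @ ks @ drop (Suc 0) vs)) (vs ! 0)) h" for h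
      by (rule sweedlers_nested[OF spaces(3)]) (use mg in simp_all)
    then have "sweedlers (Suc m) ?g h = sweedler (\<lambda>y x. sweedlers m (\<lambda>hs. ?g (hs @ [x])) y) h" for h
      by (simp add: sweedlers_Suc[of 0] sweedlers_0 split_entry_def)
    then show ?thesis by (intro arg_cong[where f = \<alpha>] ext) simp
  qed
  finally show ?case .
qed


section \<open>The cosimplicial and cyclic relations\<close>

lemma d_last_in:
  assumes f: "f \<in> C n"
  shows "d n (Suc n) f \<in> C (Suc n)"
  unfolding last_d_eq[OF f] by (intro t_in d_in f) simp

lemma cochain_add: "f \<in> C n \<Longrightarrow> g \<in> C n \<Longrightarrow> f + g \<in> C n"
  and cochain_scale: "f \<in> C n \<Longrightarrow> scale_fun sM c f \<in> C n"
proof -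
  interpret F: vector_space "scale_fun sM :: _ \<Rightarrow> (('k, 'a) tensor \<Rightarrow> _) \<Rightarrow> _"
    by (rule vector_space_scale_fun[OF spaces(3)])
  show "f \<in> C n \<Longrightarrow> g \<in> C n \<Longrightarrow> f + g \<in> C n" "f \<in> C n \<Longrightarrow> scale_fun sM c f \<in> C n"
    using F.subspace_add[OF cochains_subspace] F.subspace_scale[OF cochains_subspace] by auto
qed

lemma scale_fun_apply: "scale_fun sM c f x = sM c (f x)"
  by (simp add: scale_fun_def)

lemma linear_on_cochainsI:
  assumes maps: "\<And>f. f \<in> C m \<Longrightarrow> F f \<in> C n"
    and add: "\<And>f g as. f \<in> C m \<Longrightarrow> g \<in> C m \<Longrightarrow> length as = Suc n \<Longrightarrow>
      F (f + g) (pure as) = F f (pure as) + F g (pure as)"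
    and scale: "\<And>c f as. f \<in> C m \<Longrightarrow> length as = Suc n \<Longrightarrow>
      F (scale_fun sM c f) (pure as) = sM c (F f (pure as))"
  shows "linear_on (C m) (scale_fun sM) (scale_fun sM) F"
  unfolding linear_on_def
proof (intro conjI ballI allI)
  show "F (f + g) = F f + F g" if "f \<in> C m" "g \<in> C m" for f g
    by (rule cochain_eqI) (use that in \<open>auto intro: maps cochain_add simp: add\<close>)
  show "F (scale_fun sM c f) = scale_fun sM c (F f)" if "f \<in> C m" for c f
  proof (rule cochain_eqI)
    show "F (scale_fun sM c f) (pure as) = scale_fun sM c (F f) (pure as)" if "length as = Suc n" for as
      using scale[OF \<open>f \<in> C m\<close> that] by (simp only: scale_fun_apply)
  qed (use that in \<open>auto intro: maps cochain_scale\<close>)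
qed

lemma t_linear: "linear_on (C n) (scale_fun sM) (scale_fun sM) (t n)"
proof (rule linear_on_cochainsI)
  fix f g :: "('k, 'a) tensor \<Rightarrow> 'm" and as :: "'a list" and c
  assume f: "f \<in> C n" and as: "length as = Suc n"
  have lin: "klinear sH sM (\<lambda>h. f (pure (actA h (last as) # butlast as)))" if "f \<in> C n" for f
    using that as by (intro klinear_comp[OF cochain_klinear_Cons klinear_actA(1)]) auto
  show "t n (scale_fun sM c f) (pure as) = sM c (t n f (pure as))"
    using M.contra_scale[OF lin[OF f]] f as
    by (simp add: t_pure cochain_scale) (simp add: scale_fun_apply)
  show "t n (f + g) (pure as) = t n f (pure as) + t n g (pure as)" if "g \<in> C n"
    using M.contra_add[OF lin[OF f] lin[OF that]] f that as
    by (simp add: t_pure cochain_add)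
qed (rule t_in)

lemma d_linear:
  assumes "i \<le> n"
  shows "linear_on (C n) (scale_fun sM) (scale_fun sM) (d n i)"
proof (rule linear_on_cochainsI)
  show "d n i f \<in> C (Suc n)" if "f \<in> C n" for f by (rule d_in[OF that assms])
qed (use assms in \<open>auto simp: d_pure cochain_add cochain_scale scale_fun_apply\<close>)

lemma s_linear:
  assumes "j \<le> n"
  shows "linear_on (C (Suc n)) (scale_fun sM) (scale_fun sM) (s n j)"
proof (rule linear_on_cochainsI)
  show "s n j f \<in> C n" if "f \<in> C (Suc n)" for f by (rule s_in[OF that assms])
qed (use assms in \<open>auto simp: s_pure cochain_add cochain_scale scale_fun_apply\<close>)

lemma d_last_linear: "linear_on (C n) (scale_fun sM) (scale_fun sM) (d n (Suc n))"
  using d_linear[of 0 n] t_linear[of "Suc n"] d_in[of _ n 0]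
  by (auto simp: linear_on_def last_d_eq cochain_add cochain_scale)

lemma nth_merge_entries:
  "Suc i < length as \<Longrightarrow> k < length as - 1 \<Longrightarrow> merge_entries i as ! k =
    (if k < i then as ! k else if k = i then as ! i * as ! Suc i else as ! Suc k)"
  by (auto simp: merge_entries_def nth_append nth_Cons')

lemma nth_insert_one:
  "j < length as \<Longrightarrow> k \<le> length as \<Longrightarrow> insert_one j as ! k =
    (if k \<le> j then as ! k else if k = Suc j then 1 else as ! (k - 1))"
  by (auto simp: insert_one_def nth_append nth_Cons' min_def intro!: arg_cong[where f = "(!) as"])

lemma length_merge_entries [simp]: "Suc i < length as \<Longrightarrow> length (merge_entries i as) = length as - 1"
  by (simp add: merge_entries_def)

lemma length_insert_one [simp]: "length (insert_one j as) = Suc (length as)"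
  by (simp add: insert_one_def)

lemma d_d:
  assumes f: "f \<in> C n" and ij: "i < j" "j \<le> Suc n"
  shows "d (Suc n) j (d n i f) = d (Suc n) i (d n (j - 1) f)"
proof (rule cochain_eqI)
  fix as :: "'a list"
  assume as: "length as = Suc (Suc (Suc n))"
  have "merge_entries i (merge_entries j as) = merge_entries (j - 1) (merge_entries i as)"
    using as ij
    by (intro nth_equalityI) (auto simp: nth_merge_entries mult.assoc)
  then show "d (Suc n) j (d n i f) (pure as) = d (Suc n) i (d n (j - 1) f) (pure as)"
    using f ij as by (simp add: d_pure[of _ n] d_pure[of _ "Suc n"] d_in)
qed (use assms in \<open>auto intro!: d_in\<close>)

lemma s_s:
  assumes f: "f \<in> C (Suc (Suc n))" and ij: "i \<le> j" "j \<le> n"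
  shows "s n j (s (Suc n) i f) = s n i (s (Suc n) (Suc j) f)"
proof (rule cochain_eqI)
  fix as :: "'a list"
  assume as: "length as = Suc n"
  have "insert_one i (insert_one j as) = insert_one (Suc j) (insert_one i as)"
    using as ij by (intro nth_equalityI) (auto simp: nth_insert_one)
  then show "s n j (s (Suc n) i f) (pure as) = s n i (s (Suc n) (Suc j) f) (pure as)"
    using f ij as by (simp add: s_pure[of _ n] s_pure[of _ "Suc n"] s_in)
qed (use assms in \<open>auto intro!: s_in\<close>)

lemma s_d_less:
  assumes f: "f \<in> C (Suc n)" and ij: "i < j" "j \<le> Suc n"
  shows "s (Suc n) j (d (Suc n) i f) = d n i (s n (j - 1) f)"
proof (rule cochain_eqI)
  fix as :: "'a list"
  assume as: "length as = Suc (Suc n)"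
  have "merge_entries i (insert_one j as) = insert_one (j - 1) (merge_entries i as)"
    using as ij
    by (intro nth_equalityI) (auto simp: nth_insert_one nth_merge_entries)
  then show "s (Suc n) j (d (Suc n) i f) (pure as) = d n i (s n (j - 1) f) (pure as)"
    using f ij as by (simp add: s_pure[of _ n] s_pure[of _ "Suc n"] d_pure[of _ n] d_pure[of _ "Suc n"] s_in d_in)
qed (use assms in \<open>auto intro!: s_in d_in\<close>)

lemma s_d_greater:
  assumes f: "f \<in> C (Suc n)" and ij: "Suc j < i" "i \<le> Suc n"
  shows "s (Suc n) j (d (Suc n) i f) = d n (i - 1) (s n j f)"
proof (rule cochain_eqI)
  fix as :: "'a list"
  assume as: "length as = Suc (Suc n)"
  have "merge_entries i (insert_one j as) = insert_one j (merge_entries (i - 1) as)"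
    using as ij
    by (intro nth_equalityI) (auto simp: nth_insert_one nth_merge_entries)
  then show "s (Suc n) j (d (Suc n) i f) (pure as) = d n (i - 1) (s n j f) (pure as)"
    using f ij as by (simp add: s_pure[of _ n] s_pure[of _ "Suc n"] d_pure[of _ n] d_pure[of _ "Suc n"] s_in d_in)
qed (use assms in \<open>auto intro!: s_in d_in\<close>)

lemma s_d_id:
  assumes f: "f \<in> C n" and ij: "j \<le> n" "i = j \<or> i = Suc j" "i \<le> n"
  shows "s n j (d n i f) = f"
proof (rule cochain_eqI)
  fix as :: "'a list"
  assume as: "length as = Suc n"
  have "merge_entries i (insert_one j as) = as"
    using as ij
    by (intro nth_equalityI) (auto simp: nth_insert_one nth_merge_entries)
  then show "s n j (d n i f) (pure as) = f (pure as)"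
    using f ij as by (simp add: s_pure d_pure d_in)
qed (use assms in \<open>auto intro!: s_in d_in\<close>)

text \<open>An argument of \<open>\<alpha>\<close> that acts on the unit of \<open>A\<close> only contributes its counit, so the
  contra-counit law removes that \<open>\<alpha>\<close>. Both relations in which a unit is rotated to the front
  rest on this.\<close>

lemma contra_counit_act_one:
  assumes "klinear sA sM g"
  shows "\<alpha> (\<lambda>h. g (actA h 1)) = g 1"
  by (simp add: A.act_unit klinear_scale[OF assms] M.contra_counit)

lemma s_d_last:
  assumes f: "f \<in> C n"
  shows "s n n (d n (Suc n) f) = f"
proof (rule cochain_eqI)
  fix as :: "'a list"
  assume as: "length as = Suc n"
  then obtain a bs where bs: "as = a # bs" "length bs = n" by (auto simp: length_Suc_conv)
  have lin: "klinear sA sM (\<lambda>z. f (pure ((z * a) # bs)))"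
    using bs by (intro klinear_comp[OF cochain_klinear_Cons[OF f]] A.A.klinear_mult_left klinear_ident spaces) simp
  have "insert_one n as = as @ [1]" using as by (simp add: insert_one_def)
  then have "s n n (d n (Suc n) f) (pure as) = \<alpha> (\<lambda>h. d n 0 f (pure (actA h 1 # as)))"
    using as f by (simp add: s_pure last_d_eq t_pure d_in t_in)
  also have "\<dots> = \<alpha> (\<lambda>h. f (pure ((actA h 1 * a) # bs)))"
    using bs f by (simp add: d_pure merge_entries_def)
  also have "\<dots> = f (pure as)"
    using contra_counit_act_one[OF lin] bs by simp
  finally show "s n n (d n (Suc n) f) (pure as) = f (pure as)" .
qed (use f in \<open>auto intro!: s_in d_last_in\<close>)

lemma t_d_inner:
  assumes f: "f \<in> C n" and i: "1 \<le> i" "i \<le> n"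
  shows "t (Suc n) (d n i f) = d n (i - 1) (t n f)"
proof (rule cochain_eqI)
  fix as :: "'a list"
  assume as: "length as = Suc (Suc n)"
  let ?bs = "merge_entries (i - 1) as"
  have "merge_entries i (actA h (last as) # butlast as) = actA h (last ?bs) # butlast ?bs" for h
  proof -
    obtain cs x where as': "as = cs @ [x]" "length cs = Suc n"
      using as by (auto simp: length_Suc_conv_rev)
    have "merge_entries (i - 1) (cs @ [x]) = merge_entries (i - 1) cs @ [x]"
      using as'(2) i by (cases i) (auto simp: merge_entries_def nth_append)
    then show ?thesis
      using i as' by (cases i) (auto simp: merge_entries_def butlast_append)
  qed
  then show "t (Suc n) (d n i f) (pure as) = d n (i - 1) (t n f) (pure as)"
    using f i as by (simp add: t_pure[of _ n] t_pure[of _ "Suc n"] d_pure d_in t_in)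
qed (use assms in \<open>auto intro!: t_in d_in\<close>)

text \<open>Both sides apply \<open>f\<close> to \<open>((-) \<cdot> a\<^sup>n)((-) \<cdot> a\<^sup>n\<^sup>+\<^sup>1)\<close> in the first entry. On the left the two
  arguments come from nested applications of \<open>\<alpha>\<close>, on the right from the coproduct of a single
  argument by the module algebra law.\<close>

lemma t_d_last:
  assumes f: "f \<in> C n"
  shows "t (Suc n) (d n (Suc n) f) = d n n (t n f)"
proof (rule cochain_eqI)
  fix as :: "'a list"
  assume as: "length as = Suc (Suc n)"
  then obtain bs x y where as_eq: "as = bs @ [x, y]" and bs: "length bs = n"
    by (auto simp: length_Suc_conv_rev)
  let ?g = "\<lambda>z. f (pure (z # bs))"
  have g: "klinear sA sM ?g" using bs by (intro cochain_klinear_Cons[OF f]) simp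
  have b: "bilinear_map sH sM (\<lambda>u v. ?g (actA u x * actA v y))"
    by (intro bilinear_mapI klinear_comp[OF g] A.A.klinear_mult_left A.A.klinear_mult_right klinear_actA)
  have "t (Suc n) (d n (Suc n) f) (pure as) = \<alpha> (\<lambda>v. d n (Suc n) f (pure (actA v y # bs @ [x])))"
    using as by (simp add: t_pure[OF d_last_in[OF f]] as_eq butlast_append)
  also have "\<dots> = \<alpha> (\<lambda>v. \<alpha> (\<lambda>u. ?g (actA u x * actA v y)))"
    using bs f by (simp add: last_d_eq t_pure d_in d_pure merge_entries_def butlast_append)
  also have "\<dots> = \<alpha> (sweedler (\<lambda>u v. ?g (actA u x * actA v y)))"
    by (rule M.contra_assoc_sweedler[OF b])
  also have "sweedler (\<lambda>u v. ?g (actA u x * actA v y)) = (\<lambda>h. ?g (actA h (x * y)))"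
    by (rule ext) (simp add: klinear_sweedler_apply[OF g, symmetric] sweedler_act_product)
  also have "\<alpha> \<dots> = d n n (t n f) (pure as)"
    using bs f by (simp add: d_pure t_in t_pure as_eq merge_entries_def nth_append)
  finally show "t (Suc n) (d n (Suc n) f) (pure as) = d n n (t n f) (pure as)" .
qed (use f in \<open>auto intro!: t_in d_in d_last_in\<close>)

lemma t_d:
  assumes "1 \<le> i" "i \<le> Suc n" "f \<in> C n"
  shows "t (Suc n) (d n i f) = d n (i - 1) (t n f)"
  using assms t_d_inner[of f n i] t_d_last[of f n] by (cases "i = Suc n") auto

lemma t_s:
  assumes f: "f \<in> C (Suc n)" and i: "1 \<le> i" "i \<le> n"
  shows "t n (s n i f) = s n (i - 1) (t (Suc n) f)"
proof (rule cochain_eqI)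
  fix as :: "'a list"
  assume as: "length as = Suc n"
  let ?bs = "insert_one (i - 1) as"
  have "insert_one i (actA h (last as) # butlast as) = actA h (last ?bs) # butlast ?bs" for h
  proof -
    obtain cs x where as': "as = cs @ [x]" "length cs = n"
      using as by (auto simp: length_Suc_conv_rev)
    have "insert_one (i - 1) (cs @ [x]) = insert_one (i - 1) cs @ [x]"
      using as'(2) i by (simp add: insert_one_def)
    then show ?thesis
      using i as' by (cases i) (auto simp: insert_one_def butlast_append)
  qed
  then show "t n (s n i f) (pure as) = s n (i - 1) (t (Suc n) f) (pure as)"
    using f i as by (simp add: t_pure[of _ n] t_pure[of _ "Suc n"] s_pure s_in t_in)
qed (use assms in \<open>auto intro!: t_in s_in\<close>)

lemma t_s_zero:
  assumes f: "f \<in> C (Suc n)"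
  shows "t n (s n 0 f) = s n n (t (Suc n) (t (Suc n) f))"
proof (rule cochain_eqI)
  fix as :: "'a list"
  assume as: "length as = Suc n"
  let ?g = "\<lambda>z. \<alpha> (\<lambda>h. f (pure (actA h (last as) # z # butlast as)))"
  have g: "klinear sA sM ?g"
  proof (rule M.klinear_contra[OF spaces(2)])
    show "klinear sH sM (\<lambda>h. f (pure (actA h (last as) # z # butlast as)))" for z
      using as by (intro klinear_comp[OF cochain_klinear_Cons[OF f] klinear_actA(1)]) simp
    show "klinear sA sM (\<lambda>z. f (pure (actA h (last as) # z # butlast as)))" for h
      using multilinear_middle[OF spaces(2,3) cochain_multilinear[OF f], of "[actA h (last as)]" "butlast as"] as
      by simp
  qed
  have "insert_one n as = as @ [1]" using as by (simp add: insert_one_def)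
  then have "s n n (t (Suc n) (t (Suc n) f)) (pure as) = \<alpha> (\<lambda>h. t (Suc n) f (pure (actA h 1 # as)))"
    using f as by (simp add: s_pure t_in t_pure)
  also have "\<dots> = \<alpha> (\<lambda>h. ?g (actA h 1))"
  proof -
    have "as \<noteq> []" using as by auto
    then show ?thesis using f as by (simp add: t_pure)
  qed
  also have "\<dots> = ?g 1" by (rule contra_counit_act_one[OF g])
  also have "\<dots> = t n (s n 0 f) (pure as)"
    using f as by (simp add: t_pure s_in s_pure insert_one_def)
  finally show "t n (s n 0 f) (pure as) = s n n (t (Suc n) (t (Suc n) f)) (pure as)" ..
qed (use f in \<open>auto intro!: t_in s_in\<close>)

lemma t_power:
  assumes f: "f \<in> C n"
  shows "(t n ^^ Suc n) f = f"
proof (rule cochain_eqI[OF t_power_in[OF f] f])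
  fix as :: "'a list"
  assume as: "length as = Suc n"
  have "(t n ^^ Suc n) f (pure as) = \<alpha> (sweedlers n (\<lambda>hs. f (pure (map2 actA hs as))))"
    using t_power_pure[OF f order_refl as] by simp
  also have "sweedlers n (\<lambda>hs. f (pure (map2 actA hs as))) = (\<lambda>h. actM h (f (pure as)))"
    by (rule ext) (rule cochain_act[OF f as])
  also have "\<alpha> \<dots> = f (pure as)" by (rule M.stable)
  finally show "(t n ^^ Suc n) f (pure as) = f (pure as)" .
qed

theorem cocyclic: "cocyclic_module (scale_fun sM) C d s t"
proof -
  interpret F: vector_space "scale_fun sM :: _ \<Rightarrow> (('k, 'a) tensor \<Rightarrow> _) \<Rightarrow> _"
    by (rule vector_space_scale_fun[OF spaces(3)])
  have din: "d n i f \<in> C (Suc n)" if "i \<le> Suc n" "f \<in> C n" for n i f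
    using that d_in d_last_in by (cases "i = Suc n") auto
  show ?thesis
  proof unfold_locales
    show "F.subspace (C n)" for n by (rule cochains_subspace)
    show "d n i x \<in> C (Suc n)" if "i \<le> Suc n" "x \<in> C n" for i n x by (rule din[OF that])
    show "linear_on (C n) (scale_fun sM) (scale_fun sM) (d n i)" if "i \<le> Suc n" for i n
      using that d_linear d_last_linear by (cases "i = Suc n") auto
    show "s n j x \<in> C n" if "j \<le> n" "x \<in> C (Suc n)" for j n x by (rule s_in[OF that(2,1)])
    show "linear_on (C (Suc n)) (scale_fun sM) (scale_fun sM) (s n j)" if "j \<le> n" for j n
      by (rule s_linear[OF that])
    show "d (Suc n) j (d n i x) = d (Suc n) i (d n (j - 1) x)"
      if ij: "i < j" "j \<le> Suc (Suc n)" and x: "x \<in> C n" for i j n x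
    proof -
      consider "j \<le> Suc n" | "j = Suc (Suc n)" "i \<le> n" | "j = Suc (Suc n)" "i = Suc n"
        using ij by linarith
      then show ?thesis
      proof cases
        case 1
        then show ?thesis using d_d ij x by blast
      next
        case 2
        \<comment> \<open>Here \<open>\<delta>\<^sub>j \<delta>\<^sub>i = \<tau> \<delta>\<^sub>0 \<delta>\<^sub>i = \<tau> \<delta>\<^sub>i\<^sub>+\<^sub>1 \<delta>\<^sub>0 = \<delta>\<^sub>i \<tau> \<delta>\<^sub>0\<close>.\<close>
        have "d (Suc n) j (d n i x) = t (Suc (Suc n)) (d (Suc n) 0 (d n i x))"
          using 2 x by (simp add: last_d_eq d_in)
        also have "\<dots> = t (Suc (Suc n)) (d (Suc n) (Suc i) (d n 0 x))"
          using d_d[OF x, of 0 "Suc i"] 2 by simp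
        also have "\<dots> = d (Suc n) i (t (Suc n) (d n 0 x))"
          using t_d[of "Suc i" "Suc n" "d n 0 x"] 2 x by (simp add: d_in)
        finally show ?thesis using 2 x by (simp add: last_d_eq)
      next
        case 3
        \<comment> \<open>Both sides equal \<open>\<tau> \<tau> \<delta>\<^sub>0 \<delta>\<^sub>0 = \<tau> \<tau> \<delta>\<^sub>1 \<delta>\<^sub>0\<close>; the chain starts at the right-hand side.\<close>
        have "d (Suc n) (Suc n) (d n (Suc n) x) = d (Suc n) (Suc n) (t (Suc n) (d n 0 x))"
          using x by (simp add: last_d_eq)
        also have "\<dots> = t (Suc (Suc n)) (d (Suc n) (Suc (Suc n)) (d n 0 x))"
          using t_d[of "Suc (Suc n)" "Suc n" "d n 0 x"] x by (simp add: d_in)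
        also have "\<dots> = t (Suc (Suc n)) (t (Suc (Suc n)) (d (Suc n) 0 (d n 0 x)))"
          using x by (simp add: last_d_eq d_in)
        also have "d (Suc n) 0 (d n 0 x) = d (Suc n) 1 (d n 0 x)"
          using d_d[OF x, of 0 1] by simp
        also have "t (Suc (Suc n)) \<dots> = d (Suc n) 0 (t (Suc n) (d n 0 x))"
          using t_d[of 1 "Suc n" "d n 0 x"] x by (simp add: d_in)
        also have "t (Suc (Suc n)) \<dots> = d (Suc n) (Suc (Suc n)) (d n (Suc n) x)"
          using x by (simp add: last_d_eq[of _ n] last_d_eq[of _ "Suc n"] d_in t_in)
        finally show ?thesis using 3 by simp
      qed
    qed
    show "s n j (s (Suc n) i x) = s n i (s (Suc n) (Suc j) x)"
      if "i \<le> j" "j \<le> n" "x \<in> C (Suc (Suc n))" for i j n x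
      by (rule s_s[OF that(3,1,2)])
    show "s (Suc n) j (d (Suc n) i x) = d n i (s n (j - 1) x)"
      if "i < j" "j \<le> Suc n" "x \<in> C (Suc n)" for i j n x
      by (rule s_d_less[OF that(3,1,2)])
    show "s n j (d n i x) = x" if "j \<le> n" "i = j \<or> i = Suc j" "x \<in> C n" for i j n x
      using that s_d_id[of x n j i] s_d_last[of x n] by (cases "i = Suc n") auto
    show "s (Suc n) j (d (Suc n) i x) = d n (i - 1) (s n j x)"
      if ij: "Suc j < i" "i \<le> Suc (Suc n)" and x: "x \<in> C (Suc n)" for i j n x
    proof (cases "i = Suc (Suc n)")
      case True
      have "s (Suc n) j (d (Suc n) i x) = s (Suc n) j (t (Suc (Suc n)) (d (Suc n) 0 x))"
        using True x by (simp add: last_d_eq)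
      also have "\<dots> = t (Suc n) (s (Suc n) (Suc j) (d (Suc n) 0 x))"
        using t_s[of "d (Suc n) 0 x" "Suc n" "Suc j"] ij x True by (simp add: d_in)
      also have "\<dots> = t (Suc n) (d n 0 (s n j x))"
        using s_d_less[OF x, of 0 "Suc j"] ij True by simp
      also have "\<dots> = d n (i - 1) (s n j x)"
        using ij x True by (simp add: last_d_eq s_in)
      finally show ?thesis .
    next
      case False
      then show ?thesis using s_d_greater[OF x ij(1)] ij by simp
    qed
    show "t n x \<in> C n" if "x \<in> C n" for n x by (rule t_in[OF that])
    show "linear_on (C n) (scale_fun sM) (scale_fun sM) (t n)" for n by (rule t_linear)
    show "t (Suc n) (d n i x) = d n (i - 1) (t n x)"
      if "1 \<le> i" "i \<le> Suc n" "x \<in> C n" for i n x by (rule t_d[OF that])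
    show "t (Suc n) (d n 0 x) = d n (Suc n) x" if "x \<in> C n" for n x
      by (rule last_d_eq[OF that, symmetric])
    show "t n (s n i x) = s n (i - 1) (t (Suc n) x)"
      if "1 \<le> i" "i \<le> n" "x \<in> C (Suc n)" for i n x by (rule t_s[OF that(3,1,2)])
    show "t n (s n 0 x) = s n n (t (Suc n) (t (Suc n) x))" if "x \<in> C (Suc n)" for n x
      by (rule t_s_zero[OF that])
    show "(t n ^^ Suc n) x = x" if "x \<in> C n" for n x by (rule t_power[OF that])
  qed
qed

end


theorem theorem2:
  fixes sH :: "'k::field \<Rightarrow> 'h::{ring,monoid_mult} \<Rightarrow> 'h"
    and \<Delta> :: "'h \<Rightarrow> ('k, 'h) tensor" and \<epsilon> :: "'h \<Rightarrow> 'k" and S :: "'h \<Rightarrow> 'h"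
    and sA :: "'k \<Rightarrow> 'a::{ring,monoid_mult} \<Rightarrow> 'a" and actA :: "'h \<Rightarrow> 'a \<Rightarrow> 'a"
    and sM :: "'k \<Rightarrow> 'm::ab_group_add \<Rightarrow> 'm" and actM :: "'h \<Rightarrow> 'm \<Rightarrow> 'm"
    and \<alpha> :: "('h \<Rightarrow> 'm) \<Rightarrow> 'm"
  assumes "hopf_algebra sH \<Delta> \<epsilon> S" and "bij S"
    and "left_module_algebra sH \<Delta> \<epsilon> sA actA"
    and "stable_ayd_contramodule sH \<Delta> \<epsilon> S sM actM \<alpha>"
  shows "cocyclic_module (scale_fun sM) (cochains sH \<Delta> sA actA sM actM)
           (coface sA actA sM \<alpha>) (codegeneracy sA sM) (cyclic_operator sA actA sM \<alpha>)"
proof -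
  have "module_algebra_ayd_coefficients sH \<Delta> \<epsilon> S sA actA sM actM \<alpha>"
    by (intro module_algebra_ayd_coefficients.intro module_algebra_ayd_coefficients_axioms.intro assms)
  then show ?thesis by (rule module_algebra_ayd_coefficients.cocyclic)
qed
end
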